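(* Let $f:\mathbb{R}^d\to\mathbb{R}$ be twice continuously differentiable with minimizer $x_*$, and suppose there are constants $\mu,L,M>0$ such that: $f$ is strongly convex with parameter $\mu$; $\|\nabla f(x)-\nabla f(y)\|\le L\|x-y\|$ for all $x,y\in\mathbb{R}^d$; and $\|\nabla^2 f(x)-\nabla^2 f(x_* )\|\le M\|x-x_*\|$ for all $x\in\mathbb{R}^d$. Let $\{x_k\}_{k\ge0}$ be the iterates generated by the BFGS method with exact line search from an arbitrary initial point $x_0\in\mathbb{R}^d$ and an arbitrary symmetric positive definite initial matrix $B_0\in\mathbb{R}^{d\times d}$, and assume $x_k\ne x_*$ for all $k\ge0$. Set $\kappa=L/\mu$, $C_0=\frac{2M}{\mu^{3/2}}\sqrt{2(f(x_0)-f(x_* ))}$, $\bar B_0=\frac1LB_0$, $\tilde B_0=\nabla^2f(x_* )^{-1/2}B_0\nabla^2f(x_* )^{-1/2}$, and $\Psi(A)=\mathrm{Tr}(A)-\log\det(A)-d$. Then for every $k\ge1$, $$\frac{f(x_k)-f(x_* )}{f(x_0)-f(x_* )}\le\left(\frac{\Psi(\tilde B_0)+4C_0\Psi(\bar B_0)+12C_0\kappa\min\{2(1+C_0),\,1+\sqrt\kappa\}}{k}\right)^k.$$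
   Context: $\|\cdot\|$ is the Euclidean norm of vectors and the spectral norm of matrices; $\log$ is the natural logarithm. Since $f$ is twice differentiable, strong convexity with parameter $\mu$ and $L$-Lipschitz gradient mean $\mu I\preceq\nabla^2 f(x)\preceq LI$ for all $x$. BFGS method with exact line search: given $x_0\in\mathbb{R}^d$ and symmetric positive definite $B_0$, for $k\ge0$ put $g_k=\nabla f(x_k)$, $d_k=-B_k^{-1}g_k$, $\eta_k=\arg\min_{\eta\ge0}f(x_k+\eta d_k)$, $x_{k+1}=x_k+\eta_kd_k$, $s_k=x_{k+1}-x_k$, $y_k=\nabla f(x_{k+1})-\nabla f(x_k)$, and $$B_{k+1}=B_k-\frac{B_ks_ks_k^\top B_k}{s_k^\top B_ks_k}+\frac{y_ky_k^\top}{s_k^\top y_k}.$$ All $B_k$ are then symmetric positive definite. The standing assumption that $x_k\neq x_*$ for all $k$ ensures that all quantities are well defined. *)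

theory Defs
  imports "HOL-Analysis.Analysis"
begin

definition strongly_convex :: "real \<Rightarrow> ('a::real_inner \<Rightarrow> real) \<Rightarrow> bool" where
  "strongly_convex \<mu> f \<longleftrightarrow>
     (\<forall>x y t. 0 \<le> t \<and> t \<le> 1 \<longrightarrow>
        f ((1 - t) *\<^sub>R x + t *\<^sub>R y)
          \<le> (1 - t) * f x + t * f y - \<mu> / 2 * t * (1 - t) * (norm (x - y))\<^sup>2)"

text \<open>The norm on the type of matrices is the Frobenius norm, so the spectral norm is
  expressed as the operator norm of the induced linear map.\<close>

definition spectral_norm :: "real^'n^'n \<Rightarrow> real" where
  "spectral_norm A = onorm (\<lambda>v. A *v v)"

definition sym_pos_def :: "real^'n^'n \<Rightarrow> bool" where
  "sym_pos_def A \<longleftrightarrow> transpose A = A \<and> (\<forall>v. v \<noteq> 0 \<longrightarrow> 0 < v \<bullet> (A *v v))"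

text \<open>Meaningful only for symmetric positive definite \<open>A\<close>, which have exactly one
  symmetric positive definite square root.\<close>

definition matrix_sqrt :: "real^'n^'n \<Rightarrow> real^'n^'n" where
  "matrix_sqrt A = (THE R. sym_pos_def R \<and> R ** R = A)"

definition outer_prod :: "real^'n \<Rightarrow> real^'n \<Rightarrow> real^'n^'n" where
  "outer_prod u v = (\<chi> i j. u $ i * v $ j)"

definition bfgs_update :: "real^'n^'n \<Rightarrow> real^'n \<Rightarrow> real^'n \<Rightarrow> real^'n^'n" where
  "bfgs_update B s y =
     B - (1 / (s \<bullet> (B *v s))) *\<^sub>R (B ** outer_prod s s ** B)
       + (1 / (s \<bullet> y)) *\<^sub>R outer_prod y y"

text \<open>The argument \<open>g\<close> stands for the gradient of \<open>f\<close>.\<close>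

definition bfgs_exact_line_search ::
  "(real^'n \<Rightarrow> real) \<Rightarrow> (real^'n \<Rightarrow> real^'n) \<Rightarrow>
   (nat \<Rightarrow> real^'n) \<Rightarrow> (nat \<Rightarrow> real^'n^'n) \<Rightarrow> bool" where
  "bfgs_exact_line_search f g x B \<longleftrightarrow>
     (\<forall>k. let d = - (matrix_inv (B k) *v g (x k)) in
        (\<exists>\<eta>. is_arg_min (\<lambda>t. f (x k + t *\<^sub>R d)) (\<lambda>t. 0 \<le> t) \<eta> \<and>
             x (Suc k) = x k + \<eta> *\<^sub>R d) \<and>
        B (Suc k) = bfgs_update (B k) (x (Suc k) - x k) (g (x (Suc k)) - g (x k)))"

definition Psi :: "real^'n^'n \<Rightarrow> real" where
  "Psi A = trace A - ln (det A) - real CARD('n)"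

end

theory Submission
  imports Defs
begin

text \<open>Why the rate holds. Write \<open>gap t = f (x t) - f xs\<close> and
\<open>ratio t = 1 - gap (t + 1) / gap t\<close>, so that \<open>gap k / gap 0\<close> is the product of the factors
\<open>1 - ratio t\<close>. By the inequality of arithmetic and geometric means and
\<open>1 - r \<le> - ln r\<close>, this product is at most \<open>(X / k) ^ k\<close> as soon as
\<open>(\<Sum>t<k. - ln (ratio t)) \<le> X\<close>. A superlinear rate is thus a bound on this sum that does not
depend on \<open>k\<close>.

The sum is controlled by the potential \<open>Psi\<close>, which is nonnegative on positive definite matrices.
Fix a symmetric weight \<open>R\<close>, thought of as the inverse square root of a positive definite \<open>P\<close>. A BFGS update multiplies the determinant
by a known scalar and changes the trace by two known scalars; with an exact line search this gives
(\<open>Psi_bfgs_step_le\<close>) for the gradient difference \<open>y\<close> along the step \<open>s\<close>, with \<open>g\<close> the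
gradient at the start,
\<open>Psi (R B\<^sub>+ R) \<le> Psi (R B R) + (|R y|\<^sup>2 / (s \<bullet> y) - 1) + ln ((s \<bullet> y) / |R g|\<^sup>2)\<close>.
The argument of the last logarithm is, up to two factors, the quantity \<open>ratio t\<close>: the line search
decreases \<open>f\<close> by at least a definite fraction of \<open>s \<bullet> y = - (s \<bullet> g)\<close>
(\<open>exact_line_search_decrease\<close>), and \<open>|R g|\<^sup>2\<close> dominates the gap
(\<open>gradient_domination\<close>). Summing over \<open>t\<close> telescopes \<open>Psi\<close>.

The weight is chosen twice. With \<open>P = L I\<close> every step costs a constant, so that
\<open>(\<Sum>t<k. - ln (ratio t)) \<le> Psi (B 0 / L) + k * ln Q\<close> with a constant
\<open>Q\<close>. Once \<open>k\<close> exceeds \<open>Psi (B 0 / L)\<close> this forces exponential decay of the gap, and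
therefore a bound on the sum of \<open>sqrt (gap t)\<close>. With \<open>P = hess xs\<close> a step costs only a multiple
of the relative deviation of the Hessian from \<open>hess xs\<close> near the iterates, which is of the order of
\<open>sqrt (gap t)\<close> because the Hessian is Lipschitz at \<open>xs\<close> and \<open>f\<close> is strongly convex. The first
choice makes these costs summable, and the second then bounds the sum of \<open>- ln (ratio t)\<close>.\<close>

section \<open>Rank-one matrices and a determinant identity\<close>

text \<open>This rule turns \<open>transpose A *v v\<close> into a product of a row vector with \<open>A\<close>; below,
transposed matrices act on column vectors.\<close>

declare transpose_matrix_vector [simp del]

lemma symmetric_inner_mult:
  fixes A :: "real^'n^'n"
  assumes "transpose A = A"
  shows "(A *v v) \<bullet> w = v \<bullet> (A *v w)"
  by (metis assms dot_lmul_matrix transpose_matrix_vector)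

lemma inner_matrix_vector_transpose:
  fixes A :: "real^'n^'n"
  shows "v \<bullet> (A *v w) = (transpose A *v v) \<bullet> w"
  by (simp add: dot_lmul_matrix transpose_matrix_vector)

lemma outer_prod_mult_vec: "outer_prod u v *v w = (v \<bullet> w) *\<^sub>R u"
  by (simp add: vec_eq_iff matrix_vector_mult_def outer_prod_def inner_vec_def sum_distrib_left
      sum_distrib_right mult_ac)

lemma mult_outer_prod_mult:
  fixes A C :: "real^'n^'n"
  shows "A ** outer_prod u v ** C = outer_prod (A *v u) (transpose C *v v)"
proof -
  have "A ** outer_prod u v ** C *v w = outer_prod (A *v u) (transpose C *v v) *v w" for w
    using inner_matrix_vector_transpose [of v C w]
    by (simp add: matrix_vector_mul_assoc [symmetric] outer_prod_mult_vec matrix_vector_mult_scaleR)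
  then show ?thesis
    by (simp add: matrix_eq)
qed

lemma matrix_mult_add_left: "(A + B) ** C = A ** C + B ** (C :: real^'n^'n)"
  by (simp add: matrix_eq matrix_vector_mul_assoc [symmetric] matrix_vector_mult_add_rdistrib)

lemma trace_outer_prod: "trace (outer_prod u v) = u \<bullet> v"
  by (simp add: trace_def outer_prod_def inner_vec_def)

lemma invertible_mult_matrix_inv:
  fixes A :: "real^'n^'n"
  assumes "invertible A"
  shows "A ** matrix_inv A = mat 1" "matrix_inv A ** A = mat 1"
  using someI_ex [OF assms [unfolded invertible_def]] by (simp_all add: matrix_inv_def)

text \<open>After an orthogonal change of basis \<open>s\<close> is a multiple of a coordinate vector. The matrix then
differs from the identity in a single column, and Cramer's rule gives its determinant.\<close>

lemma det_identity_plus_outer_prod: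
  fixes p s :: "real^'n"
  shows "det (mat 1 + outer_prod p s) = 1 + s \<bullet> p"
proof (cases "s = 0")
  case True
  then have "outer_prod p s = 0"
    by (simp add: outer_prod_def vec_eq_iff)
  with True show ?thesis
    by simp
next
  case False
  obtain k :: 'n where True
    by simp
  have "norm (s /\<^sub>R norm s) = 1"
    using False by simp
  then obtain Q where Q: "orthogonal_matrix Q" and Qk: "Q *v axis k 1 = s /\<^sub>R norm s"
    by (rule orthogonal_matrix_exists_basis)
  have QQ: "transpose Q ** Q = mat 1" "Q ** transpose Q = mat 1"
    using Q by (simp_all add: orthogonal_matrix_def)
  define q where "q = transpose Q *v p"
  have Qs: "transpose Q *v s = norm s *\<^sub>R axis k 1"
  proof -
    have "s = norm s *\<^sub>R (Q *v axis k 1)"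
      using False Qk by simp
    then have "transpose Q *v s = norm s *\<^sub>R (transpose Q *v (Q *v axis k 1))"
      by (metis matrix_vector_mult_scaleR)
    also have "\<dots> = norm s *\<^sub>R axis k 1"
      by (simp add: matrix_vector_mul_assoc QQ)
    finally show ?thesis .
  qed
  have sp: "s \<bullet> p = norm s * q $ k"
  proof -
    have "s \<bullet> p = s \<bullet> (Q *v q)"
      by (simp add: q_def matrix_vector_mul_assoc QQ)
    also have "\<dots> = norm s * (axis k 1 \<bullet> q)"
      by (simp add: inner_matrix_vector_transpose Qs)
    finally show ?thesis
      by (simp add: inner_axis')
  qed
  have "transpose Q ** (mat 1 + outer_prod p s) ** Q
      = mat 1 + outer_prod q (norm s *\<^sub>R axis k 1)"
    by (simp add: matrix_add_ldistrib matrix_mult_add_left mult_outer_prod_mult QQ Qs q_def)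
  moreover have "det (transpose Q ** (mat 1 + outer_prod p s) ** Q) = det (mat 1 + outer_prod p s)"
  proof -
    have "det (transpose Q) * det Q = 1"
      by (metis QQ(1) det_I det_mul)
    then show ?thesis
      by (simp add: det_mul mult_ac)
  qed
  moreover have "mat 1 + outer_prod q (norm s *\<^sub>R axis k 1)
      = (\<chi> i j. if j = k then (mat 1 *v (axis k 1 + norm s *\<^sub>R q)) $ i else (mat 1 :: real^'n^'n) $ i $ j)"
    unfolding matrix_vector_mul_lid by (simp add: vec_eq_iff mat_def outer_prod_def axis_def)
  ultimately have "det (mat 1 + outer_prod p s) = det (\<chi> i j. if j = k
      then (mat 1 *v (axis k 1 + norm s *\<^sub>R q)) $ i else (mat 1 :: real^'n^'n) $ i $ j)"
    by simp
  also have "\<dots> = (axis k 1 + norm s *\<^sub>R q) $ k * det (mat 1 :: real^'n^'n)"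
    by (rule cramer_lemma)
  also have "\<dots> = 1 + s \<bullet> p"
    by (simp add: sp)
  finally show ?thesis .
qed

section \<open>Spectral decomposition, positive definiteness and square roots\<close>

definition diag_matrix :: "('n \<Rightarrow> real) \<Rightarrow> real^'n^'n" where
  "diag_matrix l = (\<chi> i j. if i = j then l i else 0)"

lemma diag_matrix_mult_vec: "(diag_matrix l *v v) $ i = l i * v $ i"
proof -
  have "(diag_matrix l *v v) $ i = (\<Sum>j\<in>UNIV. (if i = j then l i else 0) * v $ j)"
    by (simp only: matrix_vector_mult_def diag_matrix_def vec_lambda_beta)
  also have "\<dots> = (\<Sum>j\<in>UNIV. if i = j then l i * v $ j else 0)"
    by (rule sum.cong) auto
  finally show ?thesis
    by simp
qed

text \<open>A maximizer \<open>v\<close> of the quadratic form on the unit sphere of \<open>S\<close>, with maximum \<open>l\<close>, is an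
eigenvector. The form of \<open>l I - A\<close> is nonnegative on \<open>S\<close> and vanishes at \<open>v\<close>; moving
from \<open>v\<close> in the direction of the residual \<open>r = l v - A v\<close> changes it to first order by
\<open>2 t |r|\<^sup>2\<close>, which would be negative for small \<open>t < 0\<close> unless \<open>r = 0\<close>.\<close>

lemma symmetric_max_eigenvector:
  fixes A :: "real^'n^'n"
  assumes sym: "transpose A = A" and S: "subspace S" and inv: "\<And>v. v \<in> S \<Longrightarrow> A *v v \<in> S"
    and "S \<noteq> {0}"
  obtains v l where "v \<in> S" "norm v = 1" "A *v v = l *\<^sub>R v"
proof -
  obtain w where "w \<in> S" "w \<noteq> 0"
    using \<open>S \<noteq> {0}\<close> subspace_0 [OF S] by auto
  then have "w /\<^sub>R norm w \<in> S \<inter> sphere 0 1"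
    using S by (simp add: subspace_scale)
  moreover have "compact (S \<inter> sphere 0 1)"
    using closed_subspace [OF S] by (simp add: closed_Int_compact)
  moreover have "continuous_on (S \<inter> sphere 0 1) (\<lambda>w. w \<bullet> (A *v w))"
    by (intro continuous_intros)
  ultimately obtain v where v: "v \<in> S \<inter> sphere 0 1"
    and max: "\<And>w. w \<in> S \<inter> sphere 0 1 \<Longrightarrow> w \<bullet> (A *v w) \<le> v \<bullet> (A *v v)"
    using continuous_attains_sup [of "S \<inter> sphere 0 1" "\<lambda>w. w \<bullet> (A *v w)"] by blast
  define l where "l = v \<bullet> (A *v v)"
  define r where "r = l *\<^sub>R v - A *v v"
  have vS: "v \<in> S" and nv: "norm v = 1"
    using v by auto
  have rS: "r \<in> S"
    unfolding r_def using S vS inv by (simp add: subspace_diff subspace_scale)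
  have form: "w \<bullet> (A *v w) \<le> l * (w \<bullet> w)" if "w \<in> S" for w
  proof (cases "w = 0")
    case False
    then have "w /\<^sub>R norm w \<in> S \<inter> sphere 0 1"
      using S that by (simp add: subspace_scale)
    from max [OF this] have "w \<bullet> (A *v w) / (norm w)\<^sup>2 \<le> l"
      by (simp add: l_def matrix_vector_mult_scaleR power2_eq_square divide_simps)
    then show ?thesis
      using False by (simp add: divide_simps power2_norm_eq_inner)
  qed simp
  have key: "0 \<le> 2 * t * (r \<bullet> r) + t\<^sup>2 * (l * (r \<bullet> r) - r \<bullet> (A *v r))" for t
  proof -
    have "v + t *\<^sub>R r \<in> S"
      using S vS rS by (simp add: subspace_add subspace_scale)
    note form [OF this]
    moreover have "(v + t *\<^sub>R r) \<bullet> (A *v (v + t *\<^sub>R r))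
        = v \<bullet> (A *v v) + 2 * t * ((A *v v) \<bullet> r) + t\<^sup>2 * (r \<bullet> (A *v r))"
      using symmetric_inner_mult [OF sym, of v r] inner_commute [of r "A *v v"]
      by (simp add: matrix_vector_right_distrib matrix_vector_mult_scaleR inner_add_left
          inner_add_right power2_eq_square algebra_simps)
    moreover have "(v + t *\<^sub>R r) \<bullet> (v + t *\<^sub>R r)
        = v \<bullet> v + 2 * t * (v \<bullet> r) + t\<^sup>2 * (r \<bullet> r)"
      using inner_commute [of r v]
      by (simp add: inner_add_left inner_add_right power2_eq_square algebra_simps)
    ultimately
    have "v \<bullet> (A *v v) + 2 * t * ((A *v v) \<bullet> r) + t\<^sup>2 * (r \<bullet> (A *v r))
        \<le> l * (v \<bullet> v + 2 * t * (v \<bullet> r) + t\<^sup>2 * (r \<bullet> r))"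
      by simp
    then have "0 \<le> l * (v \<bullet> v) - v \<bullet> (A *v v) + 2 * t * (l * (v \<bullet> r) - (A *v v) \<bullet> r)
        + t\<^sup>2 * (l * (r \<bullet> r) - r \<bullet> (A *v r))"
      by (simp add: algebra_simps)
    moreover have "l * (v \<bullet> r) - (A *v v) \<bullet> r = r \<bullet> r"
      by (simp add: r_def inner_diff_left)
    moreover have "v \<bullet> v = 1"
      using nv by (simp add: norm_eq_1)
    ultimately show ?thesis
      by (simp add: l_def)
  qed
  have "r \<bullet> r = 0"
  proof (rule ccontr)
    assume "r \<bullet> r \<noteq> 0"
    then have rr: "0 < r \<bullet> r"
      using inner_ge_zero [of r] by linarith
    \<comment> \<open>A step of length \<open>t\<close> so short that the linear term beats the quadratic one.\<close>
    define c where "c = \<bar>l * (r \<bullet> r) - r \<bullet> (A *v r)\<bar> + 1"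
    have c: "0 < c" "l * (r \<bullet> r) - r \<bullet> (A *v r) \<le> c"
      by (auto simp: c_def)
    define t where "t = (r \<bullet> r) / c"
    have t: "0 < t" "t * c = r \<bullet> r"
      using rr c by (simp_all add: t_def)
    have "0 \<le> 2 * (- t) * (r \<bullet> r) + (- t)\<^sup>2 * (l * (r \<bullet> r) - r \<bullet> (A *v r))"
      by (rule key)
    also have "\<dots> \<le> - 2 * t * (r \<bullet> r) + t\<^sup>2 * c"
      using c by (simp add: mult_left_mono)
    also have "\<dots> = - t * (r \<bullet> r)"
      using t(2) by (simp add: power2_eq_square)
    finally show False
      using t rr by (simp add: mult_le_0_iff zero_le_mult_iff)
  qed
  then have "A *v v = l *\<^sub>R v"
    by (simp add: r_def)
  with vS nv that show thesis
    by blast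
qed

text \<open>Split off one eigenvector and continue in its orthogonal complement within \<open>S\<close>, which is again
invariant because \<open>A\<close> is symmetric.\<close>

lemma symmetric_invariant_subspace_eigenbasis:
  fixes A :: "real^'n^'n"
  assumes sym: "transpose A = A" and "subspace S" and "\<And>v. v \<in> S \<Longrightarrow> A *v v \<in> S"
  shows "\<exists>E. span E = S \<and> pairwise orthogonal E \<and> (\<forall>b\<in>E. norm b = 1 \<and> (\<exists>l. A *v b = l *\<^sub>R b))"
  using assms(2,3)
proof (induction "dim S" arbitrary: S rule: less_induct)
  case less
  show ?case
  proof (cases "S = {0}")
    case True
    then show ?thesis
      by (intro exI [of _ "{}"]) simp
  next
    case False
    obtain v l where v: "v \<in> S" "norm v = 1" "A *v v = l *\<^sub>R v"
      using symmetric_max_eigenvector [OF sym less.prems False] by blast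
    have vv: "v \<bullet> v = 1"
      using v by (simp add: norm_eq_1)
    define S' where "S' = S \<inter> {w. orthogonal v w}"
    have S': "subspace S'"
      unfolding S'_def using less.prems(1) subspace_orthogonal_to_vector by (rule subspace_inter)
    have inv': "A *v w \<in> S'" if "w \<in> S'" for w
    proof -
      have "v \<bullet> (A *v w) = l * (v \<bullet> w)"
        using symmetric_inner_mult [OF sym, of v w] v(3) by simp
      then show ?thesis
        using that less.prems(2) by (simp add: S'_def orthogonal_def)
    qed
    have "v \<notin> S'"
      using vv by (simp add: S'_def orthogonal_def)
    then have "span S' \<subset> span S"
      using v(1) S' less.prems(1) by (auto simp: S'_def span_eq_iff [THEN iffD2])
    then have "dim S' < dim S"
      by (rule dim_psubset)
    then obtain E where E: "span E = S'" "pairwise orthogonal E"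
      "\<forall>b\<in>E. norm b = 1 \<and> (\<exists>l. A *v b = l *\<^sub>R b)"
      using less.hyps S' inv' by blast
    have orth: "orthogonal v b" if "b \<in> E" for b
      using span_base [OF that] E(1) by (simp add: S'_def)
    have "span (insert v E) = S"
    proof
      show "span (insert v E) \<subseteq> S"
        using v(1) E(1) span_superset [of E] less.prems(1) by (intro span_minimal) (auto simp: S'_def)
    next
      show "S \<subseteq> span (insert v E)"
      proof
        fix w assume "w \<in> S"
        then have "w - (v \<bullet> w) *\<^sub>R v \<in> S'"
          using v(1) vv less.prems(1)
          by (simp add: S'_def subspace_diff subspace_scale orthogonal_def inner_diff_right)
        then show "w \<in> span (insert v E)"
          using E(1) by (auto simp: span_breakdown_eq)
      qed
    qed
    moreover have "pairwise orthogonal (insert v E)"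
      using E(2) orth by (auto simp: pairwise_insert orthogonal_commute)
    ultimately show ?thesis
      using E(3) v by (intro exI [of _ "insert v E"]) auto
  qed
qed

theorem symmetric_spectral_decomposition:
  fixes A :: "real^'n^'n"
  assumes sym: "transpose A = A"
  obtains Q l where "orthogonal_matrix Q" "A = Q ** diag_matrix l ** transpose Q"
    "\<And>i. A *v column i Q = l i *\<^sub>R column i Q" "\<And>i. norm (column i Q) = 1"
proof -
  obtain E where E: "span E = (UNIV :: (real^'n) set)" "pairwise orthogonal E"
    "\<forall>b\<in>E. norm b = 1 \<and> (\<exists>l. A *v b = l *\<^sub>R b)"
    using symmetric_invariant_subspace_eigenbasis [OF sym, of UNIV] by auto
  have ind: "independent E"
    using E by (intro pairwise_orthogonal_independent) auto
  have "card E = CARD('n)"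
    using ind E(1) dim_span_eq_card_independent by fastforce
  moreover have "finite E"
    using ind by (rule independent_imp_finite)
  ultimately obtain h where h: "bij_betw h (UNIV :: 'n set) E"
    using finite_same_card_bij [of "UNIV :: 'n set" E] by auto
  have hE: "h i \<in> E" for i
    using h by (auto simp: bij_betw_def)
  define l where "l i = (SOME l. A *v h i = l *\<^sub>R h i)" for i
  have l: "A *v h i = l i *\<^sub>R h i" for i
    unfolding l_def by (rule someI_ex) (use E(3) hE in blast)
  define Q where "Q = (\<chi> i j. h j $ i)"
  have col: "column i Q = h i" for i
    by (simp add: Q_def column_def vec_eq_iff)
  have Q: "orthogonal_matrix Q"
    unfolding orthogonal_matrix_orthonormal_columns col
  proof (intro conjI allI impI)
    fix i j :: 'n
    show "norm (h i) = 1"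
      using E(3) hE by blast
    assume "i \<noteq> j"
    then have "h i \<noteq> h j"
      using h by (auto simp: bij_betw_def inj_on_def)
    then show "orthogonal (h i) (h j)"
      using E(2) hE by (auto simp: pairwise_def)
  qed
  have "A ** Q = Q ** diag_matrix l"
  proof -
    have "(A ** Q) $ i $ j = (Q ** diag_matrix l) $ i $ j" for i j
    proof -
      have "(A ** Q) $ i $ j = (A *v h j) $ i"
        by (simp add: matrix_matrix_mult_def matrix_vector_mult_def Q_def)
      also have "\<dots> = (Q ** diag_matrix l) $ i $ j"
        by (simp add: l matrix_matrix_mult_def Q_def diag_matrix_def if_distrib cong: if_cong)
      finally show ?thesis .
    qed
    then show ?thesis
      by (simp add: vec_eq_iff)
  qed
  then have "A = Q ** diag_matrix l ** transpose Q"
    using Q by (metis orthogonal_matrix_def matrix_mul_assoc matrix_mul_rid)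
  with Q l show thesis
    using that col E(3) hE by metis
qed

lemma sym_pos_def_eigenvalues_pos:
  assumes "sym_pos_def A" "A *v v = l *\<^sub>R v" "norm v = 1"
  shows "0 < l"
proof -
  have "v \<noteq> 0" "v \<bullet> v = 1"
    using assms(3) by (auto simp: norm_eq_1)
  then show ?thesis
    using assms(1,2) by (metis inner_scaleR_right mult.right_neutral sym_pos_def_def)
qed

lemma orthogonal_conjugate_diag_matrix:
  assumes "orthogonal_matrix Q"
  shows "trace (Q ** diag_matrix l ** transpose Q) = (\<Sum>i\<in>UNIV. l i)"
    and "det (Q ** diag_matrix l ** transpose Q) = (\<Prod>i\<in>UNIV. l i)"
proof -
  have QQ: "transpose Q ** Q = mat 1"
    using assms by (simp add: orthogonal_matrix_def)
  have "trace (Q ** diag_matrix l ** transpose Q) = trace (diag_matrix l ** (transpose Q ** Q))"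
    by (metis matrix_mul_assoc trace_mul_sym)
  then show "trace (Q ** diag_matrix l ** transpose Q) = (\<Sum>i\<in>UNIV. l i)"
    by (simp add: QQ trace_def diag_matrix_def)
  have "det Q * det Q = 1"
    by (metis QQ det_I det_mul det_transpose)
  then have "det (Q ** diag_matrix l ** transpose Q) = det (diag_matrix l)"
    by (simp add: det_mul)
  also have "\<dots> = (\<Prod>i\<in>UNIV. l i)"
    by (subst det_diagonal) (simp_all add: diag_matrix_def)
  finally show "det (Q ** diag_matrix l ** transpose Q) = (\<Prod>i\<in>UNIV. l i)" .
qed

lemma sym_pos_def_det_pos:
  assumes "sym_pos_def A"
  shows "0 < det A"
proof -
  obtain Q l where Q: "orthogonal_matrix Q" and A: "A = Q ** diag_matrix l ** transpose Q"
    and e: "\<And>i. A *v column i Q = l i *\<^sub>R column i Q" "\<And>i. norm (column i Q) = 1"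
    using symmetric_spectral_decomposition assms unfolding sym_pos_def_def by blast
  have "0 < l i" for i
    using sym_pos_def_eigenvalues_pos [OF assms e] .
  then show ?thesis
    unfolding A orthogonal_conjugate_diag_matrix [OF Q] by (simp add: prod_pos)
qed

text \<open>In terms of the eigenvalues \<open>l i\<close>, \<open>Psi A\<close> is the sum of the terms
\<open>l i - ln (l i) - 1\<close>, each of which is nonnegative.\<close>

lemma Psi_nonneg:
  fixes A :: "real^'n^'n"
  assumes "sym_pos_def A"
  shows "0 \<le> Psi A"
proof -
  obtain Q l where Q: "orthogonal_matrix Q" and A: "A = Q ** diag_matrix l ** transpose Q"
    and e: "\<And>i. A *v column i Q = l i *\<^sub>R column i Q" "\<And>i. norm (column i Q) = 1"
    using symmetric_spectral_decomposition assms unfolding sym_pos_def_def by blast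
  have l: "0 < l i" for i
    using sym_pos_def_eigenvalues_pos [OF assms e] .
  have "Psi A = (\<Sum>i\<in>UNIV. l i - ln (l i) - 1)"
    unfolding Psi_def A orthogonal_conjugate_diag_matrix [OF Q]
    using l ln_prod [of UNIV l] by (simp add: sum_subtractf less_imp_neq [THEN not_sym])
  also have "\<dots> \<ge> 0"
  proof (rule sum_nonneg)
    show "0 \<le> l i - ln (l i) - 1" for i
      using ln_le_minus_one [OF l [of i]] by simp
  qed
  finally show ?thesis .
qed

lemma sym_pos_def_invertible: "sym_pos_def A \<Longrightarrow> invertible A"
  using sym_pos_def_det_pos by (force simp: invertible_det_nz)

lemma sym_pos_def_congruence:
  fixes A M :: "real^'n^'n"
  assumes A: "sym_pos_def A" and M: "invertible M"
  shows "sym_pos_def (M ** A ** transpose M)"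
  unfolding sym_pos_def_def
proof (intro conjI allI impI)
  show "transpose (M ** A ** transpose M) = M ** A ** transpose M"
    using A by (simp add: matrix_transpose_mul sym_pos_def_def matrix_mul_assoc)
next
  fix v :: "real^'n" assume "v \<noteq> 0"
  obtain N where "N ** transpose M = mat 1"
    using M by (metis invertible_left_inverse transpose_invertible)
  then have "transpose M *v v \<noteq> 0"
    using \<open>v \<noteq> 0\<close> by (metis matrix_left_invertible_ker)
  then have "0 < (transpose M *v v) \<bullet> (A *v (transpose M *v v))"
    using A by (simp add: sym_pos_def_def)
  also have "\<dots> = v \<bullet> ((M ** A ** transpose M) *v v)"
    by (simp add: matrix_vector_mul_assoc [symmetric] inner_matrix_vector_transpose [of v M])
  finally show "0 < v \<bullet> ((M ** A ** transpose M) *v v)" .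
qed

text \<open>With \<open>X = R - S\<close>, equality of the squares says \<open>R X + X S = 0\<close>. Tested on an eigenvector
\<open>v\<close> of \<open>X\<close> with eigenvalue \<open>l\<close> this becomes
\<open>l (v \<bullet> R v + v \<bullet> S v) = 0\<close>, so that all eigenvalues of \<open>X\<close> vanish.\<close>

lemma sym_pos_def_sqrt_unique:
  fixes R S :: "real^'n^'n"
  assumes R: "sym_pos_def R" and S: "sym_pos_def S" and eq: "R ** R = S ** S"
  shows "R = S"
proof -
  define X where "X = R - S"
  have symX: "transpose X = X"
    using R S by (simp add: X_def sym_pos_def_def transpose_def vec_eq_iff)
  obtain Q l where "orthogonal_matrix Q" and X: "X = Q ** diag_matrix l ** transpose Q"
    and e: "\<And>i. X *v column i Q = l i *\<^sub>R column i Q" "\<And>i. norm (column i Q) = 1"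
    by (rule symmetric_spectral_decomposition [OF symX]) blast
  have "l i = 0" for i
  proof -
    define v where "v = column i Q"
    have "v \<noteq> 0"
      using e(2) [of i] by (auto simp: v_def)
    have ev: "X *v v = l i *\<^sub>R v"
      by (simp add: v_def e)
    have "R *v (R *v v) = S *v (S *v v)"
      by (simp add: matrix_vector_mul_assoc eq)
    then have "R *v (X *v v) + X *v (S *v v) = 0"
      by (simp add: X_def matrix_vector_mult_diff_rdistrib matrix_vector_mult_diff_distrib)
    then have "v \<bullet> (R *v (X *v v)) + v \<bullet> (X *v (S *v v)) = 0"
      by (metis inner_add_right inner_zero_right)
    moreover have "v \<bullet> (X *v (S *v v)) = l i * (v \<bullet> (S *v v))"
      using symmetric_inner_mult [OF symX, of v "S *v v"] by (simp add: ev)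
    ultimately have "l i * (v \<bullet> (R *v v) + v \<bullet> (S *v v)) = 0"
      by (simp add: ev matrix_vector_mult_scaleR algebra_simps)
    moreover have "0 < v \<bullet> (R *v v)" "0 < v \<bullet> (S *v v)"
      using R S \<open>v \<noteq> 0\<close> by (auto simp: sym_pos_def_def)
    ultimately show ?thesis
      by auto
  qed
  then have "diag_matrix l = 0"
    by (simp add: diag_matrix_def vec_eq_iff)
  then have "X = 0"
    by (simp add: X)
  then show ?thesis
    by (simp add: X_def)
qed

text \<open>Existence takes roots of the eigenvalues. Together with uniqueness it makes the definite description
in \<open>matrix_sqrt\<close> meaningful.\<close>

lemma matrix_sqrt_sym_pos_def:
  fixes A :: "real^'n^'n"
  assumes "sym_pos_def A"
  shows "sym_pos_def (matrix_sqrt A)" "matrix_sqrt A ** matrix_sqrt A = A"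
proof -
  obtain Q l where Q: "orthogonal_matrix Q" and A: "A = Q ** diag_matrix l ** transpose Q"
    and e: "\<And>i. A *v column i Q = l i *\<^sub>R column i Q" "\<And>i. norm (column i Q) = 1"
    using symmetric_spectral_decomposition assms unfolding sym_pos_def_def by blast
  have l: "0 < l i" for i
    using sym_pos_def_eigenvalues_pos [OF assms e] .
  define D where "D = diag_matrix (\<lambda>i. sqrt (l i))"
  define R where "R = Q ** D ** transpose Q"
  have "sym_pos_def D"
    unfolding sym_pos_def_def
  proof (intro conjI allI impI)
    show "transpose D = D"
      by (simp add: D_def diag_matrix_def transpose_def vec_eq_iff)
    fix v :: "real^'n" assume "v \<noteq> 0"
    then obtain k where k: "v $ k \<noteq> 0"
      by (auto simp: vec_eq_iff)
    have "v \<bullet> (D *v v) = (\<Sum>i\<in>UNIV. sqrt (l i) * (v $ i)\<^sup>2)"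
      by (simp add: D_def inner_vec_def diag_matrix_mult_vec power2_eq_square mult_ac)
    also have "\<dots> > 0"
      using l k by (intro sum_pos2 [of _ k]) (auto simp: less_imp_le)
    finally show "0 < v \<bullet> (D *v v)" .
  qed
  moreover have "invertible Q"
    using Q by (auto simp: orthogonal_matrix_def invertible_def)
  ultimately have R: "sym_pos_def R"
    unfolding R_def by (rule sym_pos_def_congruence)
  have DD: "D ** D = diag_matrix l"
    using l by (simp add: D_def matrix_eq matrix_vector_mul_assoc [symmetric] vec_eq_iff
        diag_matrix_mult_vec less_imp_le)
  have "R ** R = Q ** D ** (transpose Q ** Q) ** D ** transpose Q"
    by (simp add: R_def matrix_mul_assoc)
  also have "\<dots> = A"
    using Q DD by (metis A matrix_mul_assoc matrix_mul_rid orthogonal_matrix_def)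
  finally have "sym_pos_def R \<and> R ** R = A"
    using R by simp
  moreover from this have "\<And>S. sym_pos_def S \<and> S ** S = A \<Longrightarrow> S = R"
    using sym_pos_def_sqrt_unique by metis
  ultimately have "sym_pos_def (matrix_sqrt A) \<and> matrix_sqrt A ** matrix_sqrt A = A"
    unfolding matrix_sqrt_def by (rule theI)
  then show "sym_pos_def (matrix_sqrt A)" "matrix_sqrt A ** matrix_sqrt A = A"
    by auto
qed

section \<open>The potential along a BFGS update\<close>

lemma matrix_vector_mult_uminus: "A *v (- v) = - (A *v v)" for A :: "real^'n^'n"
  by (simp add: vec_eq_iff matrix_vector_mult_def sum_negf)

lemma bfgs_update_eq_outer_prods:
  fixes B :: "real^'n^'n"
  assumes "transpose B = B"
  shows "bfgs_update B s y = B + outer_prod (- (1 / (s \<bullet> (B *v s))) *\<^sub>R (B *v s)) (B *v s)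
      + outer_prod ((1 / (s \<bullet> y)) *\<^sub>R y) y"
proof -
  have "B ** outer_prod s s ** B = outer_prod (B *v s) (B *v s)"
    by (simp add: mult_outer_prod_mult assms)
  then show ?thesis
    by (simp add: bfgs_update_def outer_prod_def vec_eq_iff)
qed

text \<open>The update is a congruence by a rank-one perturbation of the identity. This yields positive
definiteness and the determinant of the updated matrix at once.\<close>

lemma bfgs_update_factorization:
  fixes B :: "real^'n^'n"
  assumes B: "sym_pos_def B" and s: "s \<noteq> 0" and sy: "0 < s \<bullet> y"
  obtains N where "bfgs_update B s y = N ** B ** transpose N"
    "(det N)\<^sup>2 = (s \<bullet> y) / (s \<bullet> (B *v s))" "invertible N"
proof -
  define \<sigma> \<tau> where "\<sigma> = s \<bullet> (B *v s)" and "\<tau> = s \<bullet> y"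
  have pos: "0 < \<sigma>" "0 < \<tau>"
    using B s sy by (auto simp: \<sigma>_def \<tau>_def sym_pos_def_def)
  have symB: "transpose B = B"
    using B by (simp add: sym_pos_def_def)
  define c where "c = sqrt (\<sigma> / \<tau>)"
  have c: "c * c = \<sigma> / \<tau>" "0 < c"
    using pos by (auto simp: c_def)
  \<comment> \<open>\<open>p\<close> solves \<open>B s + \<sigma> p = c y\<close>, where \<open>c\<close> is chosen such that the rank-one
    term \<open>c\<^sup>2 y y\<^sup>T / \<sigma>\<close> of the congruence is \<open>y y\<^sup>T / \<tau>\<close>.\<close>
  define p where "p = (1 / \<sigma>) *\<^sub>R (c *\<^sub>R y - B *v s)"
  have p: "\<sigma> *\<^sub>R p = c *\<^sub>R y - B *v s"
    using pos by (simp add: p_def)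
  define N where "N = mat 1 + outer_prod p s"
  have N: "N *v v = v + (s \<bullet> v) *\<^sub>R p" for v
    by (simp add: N_def matrix_vector_mult_add_rdistrib outer_prod_mult_vec)
  have "transpose N = mat 1 + outer_prod s p"
    by (auto simp: N_def transpose_def mat_def outer_prod_def vec_eq_iff)
  then have NT: "transpose N *v v = v + (p \<bullet> v) *\<^sub>R s" for v
    by (simp add: matrix_vector_mult_add_rdistrib outer_prod_mult_vec)
  have "bfgs_update B s y *v v = (N ** B ** transpose N) *v v" for v
  proof -
    have "s \<bullet> (B *v v) = (B *v s) \<bullet> v"
      using symmetric_inner_mult [OF symB] by simp
    moreover have "\<sigma> * (p \<bullet> v) = c * (y \<bullet> v) - (B *v s) \<bullet> v"
      using arg_cong [OF p, of "\<lambda>w. w \<bullet> v"] by (simp add: inner_diff_left)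
    ultimately have coeff: "s \<bullet> (B *v v) + (p \<bullet> v) * \<sigma> = c * (y \<bullet> v)"
      by (simp add: mult.commute)
    have "(N ** B ** transpose N) *v v = N *v (B *v (transpose N *v v))"
      by (simp add: matrix_vector_mul_assoc matrix_mul_assoc)
    also have "\<dots> = B *v v + (p \<bullet> v) *\<^sub>R (B *v s) + (s \<bullet> (B *v v) + (p \<bullet> v) * \<sigma>) *\<^sub>R p"
      by (simp add: N NT matrix_vector_right_distrib matrix_vector_mult_scaleR inner_add_right \<sigma>_def
          scaleR_add_left scaleR_add_right)
    finally have "\<sigma> *\<^sub>R ((N ** B ** transpose N) *v v)
        = \<sigma> *\<^sub>R (B *v v) + (\<sigma> * (p \<bullet> v)) *\<^sub>R (B *v s) + (c * (y \<bullet> v)) *\<^sub>R (\<sigma> *\<^sub>R p)"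
      unfolding coeff by (simp add: scaleR_add_right mult.commute)
    also have "\<dots> = \<sigma> *\<^sub>R (B *v v) - ((B *v s) \<bullet> v) *\<^sub>R (B *v s) + ((c * c) * (y \<bullet> v)) *\<^sub>R y"
      unfolding p \<open>\<sigma> * (p \<bullet> v) = _\<close> by (simp add: algebra_simps)
    also have "\<dots> = \<sigma> *\<^sub>R (bfgs_update B s y *v v)"
      unfolding bfgs_update_eq_outer_prods [OF symB] \<sigma>_def [symmetric] \<tau>_def [symmetric] c
      using pos by (simp add: matrix_vector_mult_add_rdistrib outer_prod_mult_vec algebra_simps)
    finally show ?thesis
      using pos by simp
  qed
  then have "bfgs_update B s y = N ** B ** transpose N"
    by (simp add: matrix_eq)
  moreover have "det N = \<tau> * c / \<sigma>"
  proof -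
    have "\<sigma> * (s \<bullet> p) = c * \<tau> - \<sigma>"
      using arg_cong [OF p, of "\<lambda>w. s \<bullet> w"] by (simp add: inner_diff_right \<sigma>_def \<tau>_def)
    then show ?thesis
      using pos by (simp add: N_def det_identity_plus_outer_prod field_simps)
  qed
  moreover from this have "(det N)\<^sup>2 = \<tau> / \<sigma>"
  proof -
    have "(det N)\<^sup>2 = \<tau> * \<tau> * (c * c) / (\<sigma> * \<sigma>)"
      by (simp add: \<open>det N = \<tau> * c / \<sigma>\<close> power2_eq_square)
    then show ?thesis
      using pos by (simp add: c(1))
  qed
  moreover have "invertible N"
    using \<open>det N = \<tau> * c / \<sigma>\<close> pos c by (simp add: invertible_det_nz)
  ultimately show thesis
    using that by (simp add: \<sigma>_def \<tau>_def)
qed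

lemma sym_pos_def_bfgs_update:
  assumes "sym_pos_def B" "s \<noteq> 0" "0 < s \<bullet> y"
  shows "sym_pos_def (bfgs_update B s y)"
  using assms bfgs_update_factorization sym_pos_def_congruence by metis

lemma Psi_bfgs_update:
  fixes B R :: "real^'n^'n"
  assumes B: "sym_pos_def B" and s: "s \<noteq> 0" and sy: "0 < s \<bullet> y"
    and R: "transpose R = R" "invertible R"
  shows "Psi (R ** bfgs_update B s y ** R)
      = Psi (R ** B ** R) - (norm (R *v (B *v s)))\<^sup>2 / (s \<bullet> (B *v s))
        + (norm (R *v y))\<^sup>2 / (s \<bullet> y) - ln ((s \<bullet> y) / (s \<bullet> (B *v s)))"
proof -
  have symB: "transpose B = B" and sBs: "0 < s \<bullet> (B *v s)"
    using B s by (auto simp: sym_pos_def_def)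
  have tr: "trace (R ** bfgs_update B s y ** R)
      = trace (R ** B ** R) - (norm (R *v (B *v s)))\<^sup>2 / (s \<bullet> (B *v s)) + (norm (R *v y))\<^sup>2 / (s \<bullet> y)"
    unfolding bfgs_update_eq_outer_prods [OF symB]
    by (simp add: matrix_add_ldistrib matrix_mult_add_left mult_outer_prod_mult trace_add R
        trace_outer_prod matrix_vector_mult_uminus matrix_vector_mult_scaleR power2_norm_eq_inner)
  obtain N where N: "bfgs_update B s y = N ** B ** transpose N"
    "(det N)\<^sup>2 = (s \<bullet> y) / (s \<bullet> (B *v s))"
    using bfgs_update_factorization [OF B s sy] by blast
  have "0 < det (R ** B ** R)"
  proof -
    have "det (R ** B ** R) = (det R)\<^sup>2 * det B"
      by (simp add: det_mul power2_eq_square)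
    then show ?thesis
      using sym_pos_def_det_pos [OF B] R(2) by (simp add: invertible_det_nz)
  qed
  moreover have "det (R ** bfgs_update B s y ** R) = det (R ** B ** R) * ((s \<bullet> y) / (s \<bullet> (B *v s)))"
    unfolding N(1) N(2) [symmetric] by (simp add: det_mul power2_eq_square)
  ultimately have "ln (det (R ** bfgs_update B s y ** R))
      = ln (det (R ** B ** R)) + ln ((s \<bullet> y) / (s \<bullet> (B *v s)))"
    using sy sBs ln_mult_pos [of "det (R ** B ** R)" "(s \<bullet> y) / (s \<bullet> (B *v s))"] by simp
  with tr show ?thesis
    by (simp add: Psi_def)
qed

text \<open>For an exact line search step along the quasi-Newton direction, \<open>\<eta>\<close> is the step size and
\<open>s \<bullet> B s = \<eta> (s \<bullet> y)\<close>. The potential then changes by the terms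
\<open>ln \<eta> - \<eta> / c\<close> and \<open>|R y|\<^sup>2 / (s \<bullet> y)\<close>, where
\<open>c = (s \<bullet> y) / |R g|\<^sup>2\<close>. The step size disappears from the bound because
\<open>ln (\<eta> / c) \<le> \<eta> / c - 1\<close>.\<close>

lemma Psi_bfgs_step_le:
  fixes B R :: "real^'n^'n"
  assumes B: "sym_pos_def B" and s: "s \<noteq> 0" and sy: "0 < s \<bullet> y"
    and R: "transpose R = R" "invertible R"
    and Bs: "B *v s = - \<eta> *\<^sub>R g" and \<eta>: "0 < \<eta>" and gs: "s \<bullet> y = - (s \<bullet> g)"
  shows "Psi (R ** bfgs_update B s y ** R)
      \<le> Psi (R ** B ** R) + ((norm (R *v y))\<^sup>2 / (s \<bullet> y) - 1) + ln ((s \<bullet> y) / (norm (R *v g))\<^sup>2)"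
proof -
  define \<tau> G where "\<tau> = s \<bullet> y" and "G = (norm (R *v g))\<^sup>2"
  have "g \<noteq> 0"
    using sy gs by auto
  then have "R *v g \<noteq> 0"
    using R(2) by (metis invertible_mult_matrix_inv(2) matrix_vector_mul_assoc matrix_vector_mul_lid
        matrix_vector_mult_0_right)
  then have pos: "0 < \<tau>" "0 < G"
    using sy by (simp_all add: \<tau>_def G_def)
  have sBs: "s \<bullet> (B *v s) = \<eta> * \<tau>"
    by (simp add: Bs \<tau>_def gs)
  have "(norm (R *v (B *v s)))\<^sup>2 = \<eta>\<^sup>2 * G"
    by (simp add: Bs G_def matrix_vector_mult_uminus matrix_vector_mult_scaleR power_mult_distrib)
  then have "Psi (R ** bfgs_update B s y ** R)
      = Psi (R ** B ** R) - \<eta>\<^sup>2 * G / (\<eta> * \<tau>) + (norm (R *v y))\<^sup>2 / \<tau> - ln (\<tau> / (\<eta> * \<tau>))"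
    using Psi_bfgs_update [OF B s sy R] by (simp add: sBs \<tau>_def)
  also have "\<dots> = Psi (R ** B ** R) + (norm (R *v y))\<^sup>2 / \<tau> - \<eta> * G / \<tau> + ln \<eta>"
    using pos \<eta> by (simp add: power2_eq_square ln_div)
  finally have eq: "Psi (R ** bfgs_update B s y ** R)
      = Psi (R ** B ** R) + (norm (R *v y))\<^sup>2 / \<tau> - \<eta> * G / \<tau> + ln \<eta>" .
  have "\<eta> * G / \<tau> - ln \<eta> \<ge> 1 - ln (\<tau> / G)"
  proof -
    have "ln (\<eta> * G / \<tau>) \<le> \<eta> * G / \<tau> - 1"
      using pos \<eta> by (intro ln_le_minus_one) simp
    moreover have "ln (\<eta> * G / \<tau>) = ln \<eta> - ln (\<tau> / G)"
      using pos \<eta> by (simp add: ln_mult ln_div)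
    ultimately show ?thesis
      by simp
  qed
  with eq show ?thesis
    unfolding \<tau>_def G_def by linarith
qed

section \<open>Smooth strongly convex functions\<close>

locale smooth_strongly_convex =
  fixes f :: "real^'n \<Rightarrow> real"
    and grad :: "real^'n \<Rightarrow> real^'n"
    and hess :: "real^'n \<Rightarrow> real^'n^'n"
    and xs :: "real^'n"
    and \<mu> L M :: real
  assumes f_grad: "\<And>z. GDERIV f z :> grad z"
    and grad_hess: "\<And>z. (grad has_derivative (\<lambda>h. hess z *v h)) (at z)"
    and hess_cont: "continuous_on UNIV hess"
    and minimizer: "\<And>z. f xs \<le> f z"
    and pos: "0 < \<mu>" "0 < L" "0 < M"
    and f_strongly_convex: "strongly_convex \<mu> f"
    and grad_Lipschitz: "\<And>y z. norm (grad y - grad z) \<le> L * norm (y - z)"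
    and hess_Lipschitz: "\<And>z. spectral_norm (hess z - hess xs) \<le> M * norm (z - xs)"
begin

lemma f_line_derivative:
  "((\<lambda>u. f (x + u *\<^sub>R e)) has_real_derivative e \<bullet> grad (x + u *\<^sub>R e)) (at u)"
proof -
  have "((\<lambda>u. x + u *\<^sub>R e) has_derivative (\<lambda>h. h *\<^sub>R e)) (at u)"
    by (auto intro!: derivative_eq_intros)
  moreover have "(f has_derivative (\<lambda>h. h \<bullet> grad (x + u *\<^sub>R e))) (at (x + u *\<^sub>R e))"
    using f_grad by (simp add: gderiv_def)
  ultimately have "((\<lambda>u. f (x + u *\<^sub>R e)) has_derivative (\<lambda>h. (h *\<^sub>R e) \<bullet> grad (x + u *\<^sub>R e))) (at u)"
    by (rule has_derivative_compose)
  then show ?thesis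
    by (simp add: has_field_derivative_def mult_commute_abs)
qed

lemma grad_line_derivative:
  "((\<lambda>u. v \<bullet> grad (x + u *\<^sub>R e)) has_real_derivative v \<bullet> (hess (x + u *\<^sub>R e) *v e)) (at u)"
proof -
  have "((\<lambda>u. x + u *\<^sub>R e) has_derivative (\<lambda>h. h *\<^sub>R e)) (at u)"
    by (auto intro!: derivative_eq_intros)
  from has_derivative_compose [OF this grad_hess]
  have "((\<lambda>u. grad (x + u *\<^sub>R e)) has_derivative (\<lambda>h. hess (x + u *\<^sub>R e) *v (h *\<^sub>R e))) (at u)" .
  from has_derivative_inner_right [OF this, of v] show ?thesis
    by (simp add: has_field_derivative_def matrix_vector_mult_scaleR mult_commute_abs)
qed

lemma taylor_second_order:
  obtains z where "z \<in> closed_segment x y"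
    "f y = f x + (y - x) \<bullet> grad x + (y - x) \<bullet> (hess z *v (y - x)) / 2"
proof -
  define e where "e = y - x"
  define diff where "diff m u = (if m = 0 then f (x + u *\<^sub>R e) else if m = 1 then e \<bullet> grad (x + u *\<^sub>R e)
    else e \<bullet> (hess (x + u *\<^sub>R e) *v e))" for m :: nat and u :: real
  have "\<exists>t>0. t < 1 \<and> f (x + 1 *\<^sub>R e) = (\<Sum>m<2. diff m 0 / fact m * 1 ^ m) + diff 2 t / fact 2 * 1 ^ 2"
  proof (rule Maclaurin)
    show "diff 0 = (\<lambda>u. f (x + u *\<^sub>R e))"
      by (rule ext) (simp add: diff_def)
    show "\<forall>m t. m < 2 \<and> 0 \<le> t \<and> t \<le> 1 \<longrightarrow> (diff m has_real_derivative diff (Suc m) t) (at t)"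
    proof (intro allI impI)
      fix m :: nat and t :: real assume "m < 2 \<and> 0 \<le> t \<and> t \<le> 1"
      then consider "m = 0" | "m = 1"
        by linarith
      then show "(diff m has_real_derivative diff (Suc m) t) (at t)"
        using f_line_derivative [of x e t] grad_line_derivative [of e x e t]
        by cases (simp_all add: diff_def [abs_def])
    qed
  qed simp_all
  then obtain t where t: "0 < t" "t < 1"
    and eq: "f (x + 1 *\<^sub>R e) = (\<Sum>m<2. diff m 0 / fact m * 1 ^ m) + diff 2 t / fact 2 * 1 ^ 2"
    by blast
  have "x + t *\<^sub>R e \<in> closed_segment x y"
    using t by (auto simp: in_segment e_def algebra_simps intro!: exI [of _ t])
  moreover have "f y = f x + (y - x) \<bullet> grad x + (y - x) \<bullet> (hess (x + t *\<^sub>R e) *v (y - x)) / 2"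
    using eq by (simp add: diff_def e_def numeral_2_eq_2)
  ultimately show thesis
    by (rule that)
qed

text \<open>The left-hand side is symmetric in \<open>u\<close> and \<open>v\<close>, while the right-hand side tends to the mixed
second derivative as \<open>h\<close> tends to zero; the symmetry of the Hessian follows.\<close>

lemma second_difference_eq:
  assumes "0 < h"
  obtains a b where "0 < a" "a < h" "0 < b" "b < h"
    "f (z + h *\<^sub>R u + h *\<^sub>R v) - f (z + h *\<^sub>R u) - f (z + h *\<^sub>R v) + f z
      = h\<^sup>2 * (u \<bullet> (hess (z + a *\<^sub>R u + b *\<^sub>R v) *v v))"
proof -
  define \<phi> where "\<phi> t = f ((z + h *\<^sub>R v) + t *\<^sub>R u) - f (z + t *\<^sub>R u)" for t
  have "\<exists>a>0. a < h \<and> \<phi> h - \<phi> 0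
      = (h - 0) * (u \<bullet> grad ((z + h *\<^sub>R v) + a *\<^sub>R u) - u \<bullet> grad (z + a *\<^sub>R u))"
    using assms unfolding \<phi>_def by (intro MVT2 DERIV_diff f_line_derivative)
  then obtain a where a: "0 < a" "a < h"
    "\<phi> h - \<phi> 0 = h * (u \<bullet> grad ((z + h *\<^sub>R v) + a *\<^sub>R u) - u \<bullet> grad (z + a *\<^sub>R u))"
    by auto
  have "\<exists>b>0. b < h \<and> u \<bullet> grad ((z + a *\<^sub>R u) + h *\<^sub>R v) - u \<bullet> grad ((z + a *\<^sub>R u) + 0 *\<^sub>R v)
      = (h - 0) * (u \<bullet> (hess ((z + a *\<^sub>R u) + b *\<^sub>R v) *v v))"
    using assms by (intro MVT2 grad_line_derivative)
  then obtain b where b: "0 < b" "b < h"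
    "u \<bullet> grad ((z + a *\<^sub>R u) + h *\<^sub>R v) - u \<bullet> grad (z + a *\<^sub>R u)
      = h * (u \<bullet> (hess ((z + a *\<^sub>R u) + b *\<^sub>R v) *v v))"
    by auto
  have "f (z + h *\<^sub>R u + h *\<^sub>R v) - f (z + h *\<^sub>R u) - f (z + h *\<^sub>R v) + f z = \<phi> h - \<phi> 0"
    by (simp add: \<phi>_def add_ac)
  also have "\<dots> = h\<^sup>2 * (u \<bullet> (hess (z + a *\<^sub>R u + b *\<^sub>R v) *v v))"
    using a(3) b(3) by (simp add: add_ac power2_eq_square)
  finally show thesis
    using a b that by blast
qed

lemma hess_symmetric: "transpose (hess z) = hess z"
proof -
  have eq: "u \<bullet> (hess z *v v) = v \<bullet> (hess z *v u)" for u v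
  proof -
    define h where "h n = 1 / real (Suc n)" for n
    have h: "0 < h n" for n
      by (simp add: h_def)
    have h0: "h \<longlonglongrightarrow> 0"
      unfolding h_def by (rule LIMSEQ_Suc [OF lim_1_over_n])
    have ex: "\<exists>a b a' b'. 0 < a \<and> a < h n \<and> 0 < b \<and> b < h n \<and> 0 < a' \<and> a' < h n \<and> 0 < b' \<and> b' < h n
        \<and> u \<bullet> (hess (z + a *\<^sub>R u + b *\<^sub>R v) *v v) = v \<bullet> (hess (z + a' *\<^sub>R v + b' *\<^sub>R u) *v u)" for n
    proof -
      obtain a b where ab: "0 < a" "a < h n" "0 < b" "b < h n"
        "f (z + h n *\<^sub>R u + h n *\<^sub>R v) - f (z + h n *\<^sub>R u) - f (z + h n *\<^sub>R v) + f z
          = (h n)\<^sup>2 * (u \<bullet> (hess (z + a *\<^sub>R u + b *\<^sub>R v) *v v))"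
        using second_difference_eq [OF h] by blast
      obtain a' b' where ab': "0 < a'" "a' < h n" "0 < b'" "b' < h n"
        "f (z + h n *\<^sub>R v + h n *\<^sub>R u) - f (z + h n *\<^sub>R v) - f (z + h n *\<^sub>R u) + f z
          = (h n)\<^sup>2 * (v \<bullet> (hess (z + a' *\<^sub>R v + b' *\<^sub>R u) *v u))"
        using second_difference_eq [OF h] by blast
      have swap: "z + h n *\<^sub>R v + h n *\<^sub>R u = z + h n *\<^sub>R u + h n *\<^sub>R v"
        by (simp add: add_ac)
      have "(h n)\<^sup>2 * (u \<bullet> (hess (z + a *\<^sub>R u + b *\<^sub>R v) *v v))
          = (h n)\<^sup>2 * (v \<bullet> (hess (z + a' *\<^sub>R v + b' *\<^sub>R u) *v u))"
        using ab(5) ab'(5) unfolding swap by linarith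
      then have "u \<bullet> (hess (z + a *\<^sub>R u + b *\<^sub>R v) *v v) = v \<bullet> (hess (z + a' *\<^sub>R v + b' *\<^sub>R u) *v u)"
        using h [of n] by simp
      with ab ab' show ?thesis
        by blast
    qed
    obtain a b a' b' where
      bounds: "\<And>n. 0 < a n" "\<And>n. a n < h n" "\<And>n. 0 < b n" "\<And>n. b n < h n"
        "\<And>n. 0 < a' n" "\<And>n. a' n < h n" "\<And>n. 0 < b' n" "\<And>n. b' n < h n"
      and eq: "\<And>n. u \<bullet> (hess (z + a n *\<^sub>R u + b n *\<^sub>R v) *v v)
                 = v \<bullet> (hess (z + a' n *\<^sub>R v + b' n *\<^sub>R u) *v u)"
      using ex by metis
    have squeeze: "w \<longlonglongrightarrow> 0" if "\<And>n. 0 < w n" "\<And>n. w n < h n" for w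
      using that by (intro tendsto_sandwich [OF _ _ tendsto_const h0]) (auto intro: always_eventually less_imp_le)
    have lim: "(\<lambda>n. v1 \<bullet> (hess (z + c n *\<^sub>R v1 + d n *\<^sub>R v2) *v v2)) \<longlonglongrightarrow> v1 \<bullet> (hess z *v v2)"
      if "c \<longlonglongrightarrow> 0" "d \<longlonglongrightarrow> 0" for c d v1 v2
    proof -
      have "(\<lambda>n. z + c n *\<^sub>R v1 + d n *\<^sub>R v2) \<longlonglongrightarrow> z + 0 *\<^sub>R v1 + 0 *\<^sub>R v2"
        by (intro tendsto_intros that)
      moreover have "isCont hess z"
        using hess_cont by (simp add: continuous_on_eq_continuous_at)
      ultimately have "(\<lambda>n. hess (z + c n *\<^sub>R v1 + d n *\<^sub>R v2)) \<longlonglongrightarrow> hess z"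
        by (auto intro: isCont_tendsto_compose)
      moreover have "linear (\<lambda>A :: real^'n^'n. v1 \<bullet> (A *v v2))"
        by (intro linearI) (simp_all add: matrix_vector_mult_add_rdistrib inner_add_right
            scaleR_matrix_vector_assoc [symmetric])
      then have "bounded_linear (\<lambda>A :: real^'n^'n. v1 \<bullet> (A *v v2))"
        by (simp add: linear_conv_bounded_linear)
      ultimately show ?thesis
        by (rule bounded_linear.tendsto [rotated])
    qed
    have "(\<lambda>n. u \<bullet> (hess (z + a n *\<^sub>R u + b n *\<^sub>R v) *v v)) \<longlonglongrightarrow> u \<bullet> (hess z *v v)"
      by (intro lim squeeze [of a] squeeze [of b] bounds)
    then have "(\<lambda>n. v \<bullet> (hess (z + a' n *\<^sub>R v + b' n *\<^sub>R u) *v u)) \<longlonglongrightarrow> u \<bullet> (hess z *v v)"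
      unfolding eq .
    moreover have "(\<lambda>n. v \<bullet> (hess (z + a' n *\<^sub>R v + b' n *\<^sub>R u) *v u)) \<longlonglongrightarrow> v \<bullet> (hess z *v u)"
      by (intro lim squeeze [of a'] squeeze [of b'] bounds)
    ultimately show ?thesis
      by (rule LIMSEQ_unique)
  qed
  have "hess z $ i $ j = hess z $ j $ i" for i j
  proof -
    have "axis k 1 \<bullet> (hess z *v axis l 1) = hess z $ k $ l" for k l
      by (simp add: inner_axis' matrix_vector_mult_basis column_def)
    with eq show ?thesis
      by metis
  qed
  then show ?thesis
    by (simp add: transpose_def vec_eq_iff)
qed

text \<open>The strong convexity inequality at \<open>x + t (y - x)\<close>, divided by \<open>t\<close>, passes to the limit
\<open>t \<rightarrow> 0\<close>.\<close>

lemma strong_convexity_tangent: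
  "f x + (y - x) \<bullet> grad x + \<mu> / 2 * (norm (y - x))\<^sup>2 \<le> f y"
proof -
  define q where "q t = (f (x + t *\<^sub>R (y - x)) - f x) / t" for t
  have "(q \<longlongrightarrow> (y - x) \<bullet> grad x) (at 0)"
    using f_line_derivative [of x "y - x" 0] by (simp add: DERIV_def q_def [abs_def])
  then have lim: "(q \<longlongrightarrow> (y - x) \<bullet> grad x) (at_right 0)"
    by (rule filterlim_mono [OF _ order_refl at_le]) simp
  have lim': "((\<lambda>t. f y - f x - \<mu> / 2 * (1 - t) * (norm (x - y))\<^sup>2)
      \<longlongrightarrow> f y - f x - \<mu> / 2 * (1 - 0) * (norm (x - y))\<^sup>2) (at_right 0)"
    by (intro tendsto_intros)
  have "q t \<le> f y - f x - \<mu> / 2 * (1 - t) * (norm (x - y))\<^sup>2" if "0 < t" "t < 1" for t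
  proof -
    have "f ((1 - t) *\<^sub>R x + t *\<^sub>R y)
          \<le> (1 - t) * f x + t * f y - \<mu> / 2 * t * (1 - t) * (norm (x - y))\<^sup>2"
      using f_strongly_convex that unfolding strongly_convex_def by simp
    moreover have "(1 - t) *\<^sub>R x + t *\<^sub>R y = x + t *\<^sub>R (y - x)"
      by (simp add: algebra_simps)
    ultimately have "f (x + t *\<^sub>R (y - x)) - f x
        \<le> t * (f y - f x - \<mu> / 2 * (1 - t) * (norm (x - y))\<^sup>2)"
      by (simp add: algebra_simps)
    then show ?thesis
      using that by (simp add: q_def pos_divide_le_eq mult.commute)
  qed
  then have "\<forall>\<^sub>F t in at_right 0. q t \<le> f y - f x - \<mu> / 2 * (1 - t) * (norm (x - y))\<^sup>2"
    by (auto simp: eventually_at_right_field intro!: exI [of _ 1])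
  from tendsto_le [OF _ lim' lim this] show ?thesis
    by (simp add: norm_minus_commute)
qed

text \<open>The second derivative along a line is a limit of difference quotients of the gradient. Strong
monotonicity (the sum of two tangent inequalities) bounds these from below, and the Lipschitz
condition bounds them from above.\<close>

lemma hess_bounds:
  "\<mu> * (norm v)\<^sup>2 \<le> v \<bullet> (hess z *v v)" "v \<bullet> (hess z *v v) \<le> L * (norm v)\<^sup>2"
proof -
  define q where "q u = (v \<bullet> grad (z + u *\<^sub>R v) - v \<bullet> grad z) / u" for u
  have "(q \<longlongrightarrow> v \<bullet> (hess z *v v)) (at 0)"
    using grad_line_derivative [of v z v 0] by (simp add: DERIV_def q_def [abs_def])
  then have lim: "(q \<longlongrightarrow> v \<bullet> (hess z *v v)) (at_right 0)"
    by (rule filterlim_mono [OF _ order_refl at_le]) simp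
  have "\<mu> * (norm v)\<^sup>2 \<le> q u \<and> q u \<le> L * (norm v)\<^sup>2" if "0 < u" for u
  proof -
    define w where "w = z + u *\<^sub>R v"
    have "u * (\<mu> * (u * (norm v)\<^sup>2)) \<le> u * (v \<bullet> grad w - v \<bullet> grad z)"
      using strong_convexity_tangent [of z w] strong_convexity_tangent [of w z] that
      by (simp add: w_def power_mult_distrib power2_eq_square algebra_simps)
    then have "\<mu> * (norm v)\<^sup>2 \<le> q u"
      using that by (simp add: q_def w_def pos_le_divide_eq mult_ac)
    moreover have "v \<bullet> grad w - v \<bullet> grad z \<le> norm v * norm (grad w - grad z)"
      by (metis inner_diff_right norm_cauchy_schwarz)
    then have "v \<bullet> grad w - v \<bullet> grad z \<le> norm v * (L * (u * norm v))"
      using grad_Lipschitz [of w z] that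
      by (smt (verit) abs_of_pos add_diff_cancel_left' mult_left_mono norm_ge_zero norm_scaleR w_def)
    then have "q u \<le> L * (norm v)\<^sup>2"
      using that by (simp add: q_def w_def pos_divide_le_eq power2_eq_square mult_ac)
    ultimately show ?thesis
      by simp
  qed
  then have ev: "\<forall>\<^sub>F u in at_right 0. \<mu> * (norm v)\<^sup>2 \<le> q u" "\<forall>\<^sub>F u in at_right 0. q u \<le> L * (norm v)\<^sup>2"
    by (auto simp: eventually_at_right_field intro!: exI [of _ 1])
  show "\<mu> * (norm v)\<^sup>2 \<le> v \<bullet> (hess z *v v)"
    using lim ev(1) by (rule tendsto_lowerbound) simp
  show "v \<bullet> (hess z *v v) \<le> L * (norm v)\<^sup>2"
    using lim ev(2) by (rule tendsto_upperbound) simp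
qed

lemma sym_pos_def_hess: "sym_pos_def (hess z)"
  unfolding sym_pos_def_def
proof (intro conjI allI impI hess_symmetric)
  fix v :: "real^'n" assume "v \<noteq> 0"
  then have "0 < \<mu> * (norm v)\<^sup>2"
    using pos by simp
  then show "0 < v \<bullet> (hess z *v v)"
    using hess_bounds(1) [of v z] by linarith
qed

lemma mu_le_L: "\<mu> \<le> L"
proof -
  obtain k :: 'n where True
    by simp
  then show ?thesis
    using hess_bounds [of "axis k 1" xs] by simp
qed

lemma grad_minimizer: "grad xs = 0"
proof -
  have "(\<lambda>h. h \<bullet> grad xs) = (\<lambda>h. 0)"
    using f_grad [of xs] minimizer unfolding gderiv_def
    by (intro differential_zero_maxmin [of xs UNIV f]) auto
  then have "grad xs \<bullet> grad xs = 0"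
    by meson
  then show ?thesis
    by simp
qed

lemma dist_minimizer_le: "norm (z - xs) \<le> sqrt (2 * (f z - f xs) / \<mu>)"
proof (rule real_le_rsqrt)
  show "(norm (z - xs))\<^sup>2 \<le> 2 * (f z - f xs) / \<mu>"
    using strong_convexity_tangent [of xs z]
    by (simp add: grad_minimizer pos_le_divide_eq [OF pos(1)] mult.commute)
qed

lemma hess_near_minimizer:
  "\<bar>v \<bullet> (hess z *v v) - v \<bullet> (hess xs *v v)\<bar> \<le> M * norm (z - xs) * (norm v)\<^sup>2"
proof -
  have "norm ((hess z - hess xs) *v v) \<le> spectral_norm (hess z - hess xs) * norm v"
    unfolding spectral_norm_def
    by (rule onorm) (rule matrix_vector_mul_bounded_linear)
  also have "\<dots> \<le> M * norm (z - xs) * norm v"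
    using hess_Lipschitz by (intro mult_right_mono) auto
  finally have "norm v * norm ((hess z - hess xs) *v v) \<le> norm v * (M * norm (z - xs) * norm v)"
    by (intro mult_left_mono) auto
  moreover have "\<bar>v \<bullet> ((hess z - hess xs) *v v)\<bar> \<le> norm v * norm ((hess z - hess xs) *v v)"
    by (rule Cauchy_Schwarz_ineq2)
  ultimately show ?thesis
    by (simp add: matrix_vector_mult_diff_rdistrib inner_diff_right power2_eq_square mult_ac)
qed

text \<open>If \<open>H\<close> is the average of the Hessians over the segment, then \<open>H (y - x)\<close> is the gradient
difference and \<open>H \<preceq> c P\<close>, and the claim compares the inverses of \<open>H\<close> and
\<open>P\<close> on that difference. This can be seen without averaging: for the Hessian \<open>H\<close> at any point of the segment and \<open>s = y - x\<close>, nonnegativity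
of \<open>(w - c s) \<bullet> H (w - c s)\<close> bounds \<open>w \<bullet> H s\<close>, and this says that the function
\<open>\<psi>\<close> below is nonincreasing.\<close>

lemma secant_norm_le:
  fixes P :: "real^'n^'n"
  assumes c: "0 < c" and H: "\<And>z v. z \<in> closed_segment x y \<Longrightarrow> v \<bullet> (hess z *v v) \<le> c * (v \<bullet> (P *v v))"
    and w: "P *v w = grad y - grad x"
  shows "w \<bullet> (grad y - grad x) \<le> c * ((y - x) \<bullet> (grad y - grad x))"
proof -
  define s where "s = y - x"
  define W where "W = w \<bullet> (grad y - grad x)"
  define \<psi> where "\<psi> u = w \<bullet> grad (x + u *\<^sub>R s) - c / 2 * (s \<bullet> grad (x + u *\<^sub>R s)) - W / 2 * u" for u
  have "\<psi> 1 \<le> \<psi> 0"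
  proof (rule DERIV_nonpos_imp_nonincreasing [of 0 1 \<psi>])
    fix u :: real assume u: "0 \<le> u" "u \<le> 1"
    define H where "H = hess (x + u *\<^sub>R s)"
    have "(\<psi> has_real_derivative w \<bullet> (H *v s) - c / 2 * (s \<bullet> (H *v s)) - W / 2 * 1) (at u)"
      unfolding \<psi>_def H_def
      by (intro DERIV_diff DERIV_cmult grad_line_derivative DERIV_ident)
    moreover have "w \<bullet> (H *v s) - c / 2 * (s \<bullet> (H *v s)) - W / 2 * 1 \<le> 0"
    proof -
      have "x + u *\<^sub>R s \<in> closed_segment x y"
        using u by (auto simp: in_segment s_def algebra_simps intro!: exI [of _ u])
      then have 1: "w \<bullet> (H *v w) \<le> c * W"
        using assms(2) [of "x + u *\<^sub>R s" w] by (simp add: H_def W_def w)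
      have "0 \<le> \<mu> * (norm (w - c *\<^sub>R s))\<^sup>2"
        using pos by simp
      also have "\<dots> \<le> (w - c *\<^sub>R s) \<bullet> (H *v (w - c *\<^sub>R s))"
        unfolding H_def by (rule hess_bounds)
      also have "\<dots> = w \<bullet> (H *v w) - 2 * c * (w \<bullet> (H *v s)) + c * c * (s \<bullet> (H *v s))"
      proof -
        have "s \<bullet> (H *v w) = w \<bullet> (H *v s)"
          using symmetric_inner_mult [OF hess_symmetric, of "x + u *\<^sub>R s" s w]
          by (simp add: H_def inner_commute)
        then show ?thesis
          by (simp add: matrix_vector_mult_diff_distrib matrix_vector_mult_scaleR inner_diff_left
              inner_diff_right algebra_simps)
      qed
      finally have "0 \<le> c * (W - 2 * (w \<bullet> (H *v s)) + c * (s \<bullet> (H *v s)))"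
        using 1 by (simp add: algebra_simps)
      then show ?thesis
        using c by (simp add: zero_le_mult_iff)
    qed
    ultimately show "\<exists>D. (\<psi> has_real_derivative D) (at u) \<and> D \<le> 0"
      by blast
  qed simp
  then have "w \<bullet> grad y - c / 2 * (s \<bullet> grad y) - W / 2 \<le> w \<bullet> grad x - c / 2 * (s \<bullet> grad x)"
    by (simp add: \<psi>_def s_def)
  then show ?thesis
    unfolding s_def [symmetric] W_def inner_diff_right right_diff_distrib by (simp add: field_simps)
qed

text \<open>Under a lower bound on the curvature, relative to \<open>P = S S\<close>, along the segment to the minimizer, the
second-order expansion at \<open>x\<close> leaves a linear term \<open>|S e| |R g|\<close> minus
\<open>|S e|\<^sup>2 / (2 c)\<close>, where \<open>e = x - xs\<close> and \<open>g\<close> is the gradient at \<open>x\<close>. The maximum over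
\<open>|S e|\<close> is \<open>c |R g|\<^sup>2 / 2\<close>.\<close>

lemma gradient_domination:
  fixes R S :: "real^'n^'n"
  assumes c: "0 < c"
    and H: "\<And>z. z \<in> closed_segment x xs \<Longrightarrow>
          (norm (S *v (x - xs)))\<^sup>2 \<le> c * ((x - xs) \<bullet> (hess z *v (x - xs)))"
    and R: "transpose R = R" "R ** S = mat 1"
  shows "2 * (f x - f xs) \<le> c * (norm (R *v grad x))\<^sup>2"
proof -
  define e where "e = x - xs"
  define a b where "a = norm (S *v e)" and "b = norm (R *v grad x)"
  obtain z where z: "z \<in> closed_segment x xs"
    "f xs = f x + (xs - x) \<bullet> grad x + (xs - x) \<bullet> (hess z *v (xs - x)) / 2"
    using taylor_second_order by blast
  have "xs - x = - e"
    by (simp add: e_def)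
  then have fx: "f x - f xs = e \<bullet> grad x - e \<bullet> (hess z *v e) / 2"
    using z(2) by (simp add: matrix_vector_mult_uminus)
  have "e \<bullet> grad x = (R *v (S *v e)) \<bullet> grad x"
    by (simp add: matrix_vector_mul_assoc R)
  also have "\<dots> = (S *v e) \<bullet> (R *v grad x)"
    by (rule symmetric_inner_mult [OF R(1)])
  also have "\<dots> \<le> a * b"
    unfolding a_def b_def by (rule norm_cauchy_schwarz)
  finally have "c * (2 * (f x - f xs)) \<le> c * (2 * (a * b)) - c * (e \<bullet> (hess z *v e))"
    unfolding fx using c by (simp add: right_diff_distrib)
  also have "\<dots> \<le> c * (2 * (a * b)) - a\<^sup>2"
    using H [OF z(1)] by (simp add: a_def e_def)
  also have "\<dots> \<le> c * (c * b\<^sup>2)"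
    using zero_le_power2 [of "a - c * b"] by (simp add: power2_eq_square algebra_simps)
  finally show ?thesis
    using c by (simp add: b_def)
qed

text \<open>Compare both end points with the intermediate point \<open>w\<close> at the fraction
\<open>\<tau> = 1 / (1 + \<sigma>)\<close> of the step: from \<open>x\<close> the upper curvature bound limits \<open>f w\<close> from above,
from \<open>y\<close>, where the slope is zero, the lower one limits it from below. For this \<open>\<tau>\<close> the two
quadratic terms \<open>\<tau>\<^sup>2 \<sigma>\<^sup>2 a / 2\<close> and \<open>(1 - \<tau>)\<^sup>2 a / 2\<close> are equal and
cancel.\<close>

lemma exact_line_search_decrease:
  assumes exact: "(y - x) \<bullet> grad y = 0" and \<sigma>: "0 \<le> \<sigma>"
    and H: "\<And>z. z \<in> closed_segment x y \<Longrightarrow> a \<le> (y - x) \<bullet> (hess z *v (y - x))"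
      "\<And>z. z \<in> closed_segment x y \<Longrightarrow> (y - x) \<bullet> (hess z *v (y - x)) \<le> \<sigma>\<^sup>2 * a"
  shows "- ((y - x) \<bullet> grad x) \<le> (1 + \<sigma>) * (f x - f y)"
proof -
  define s where "s = y - x"
  define \<tau> where "\<tau> = 1 / (1 + \<sigma>)"
  have \<tau>: "0 < \<tau>" "\<tau> \<le> 1" "1 - \<tau> = \<sigma> * \<tau>" "(1 + \<sigma>) * \<tau> = 1"
    using \<sigma> by (simp_all add: \<tau>_def field_simps)
  define w where "w = x + \<tau> *\<^sub>R s"
  have w: "w \<in> closed_segment x y"
    using \<tau> by (auto simp: in_segment s_def w_def algebra_simps intro!: exI [of _ \<tau>])
  have wx: "w - x = \<tau> *\<^sub>R s"
    by (simp add: w_def)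
  have wy: "w - y = - ((\<sigma> * \<tau>) *\<^sub>R s)"
    unfolding \<tau>(3) [symmetric] by (simp add: w_def s_def algebra_simps)
  obtain z where z: "z \<in> closed_segment x w"
    "f w = f x + (w - x) \<bullet> grad x + (w - x) \<bullet> (hess z *v (w - x)) / 2"
    using taylor_second_order by blast
  have "z \<in> closed_segment x y"
    using z(1) w by (meson ends_in_segment(1) subset_closed_segment subsetD)
  then have "\<tau> * \<tau> * (s \<bullet> (hess z *v s)) \<le> \<tau> * \<tau> * (\<sigma>\<^sup>2 * a)"
    using H(2) by (intro mult_left_mono) (auto simp: s_def)
  then have upper: "f w \<le> f x + \<tau> * (s \<bullet> grad x) + \<tau> * \<tau> * (\<sigma>\<^sup>2 * a) / 2"
    using z(2) unfolding wx by (simp add: matrix_vector_mult_scaleR mult_ac)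
  obtain z' where z': "z' \<in> closed_segment y w"
    "f w = f y + (w - y) \<bullet> grad y + (w - y) \<bullet> (hess z' *v (w - y)) / 2"
    using taylor_second_order by blast
  have "z' \<in> closed_segment x y"
    using z'(1) w by (meson ends_in_segment(2) subset_closed_segment subsetD)
  then have "(\<sigma> * \<tau>)\<^sup>2 * a \<le> (\<sigma> * \<tau>)\<^sup>2 * (s \<bullet> (hess z' *v s))"
    using H(1) by (intro mult_left_mono) (auto simp: s_def)
  then have lower: "f y + (\<sigma> * \<tau>)\<^sup>2 * a / 2 \<le> f w"
    using z'(2) exact unfolding wy
    by (simp add: matrix_vector_mult_scaleR matrix_vector_mult_uminus power2_eq_square
        s_def [symmetric] mult_ac)
  have "- \<tau> * (s \<bullet> grad x) \<le> f x - f y"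
    using upper lower by (simp add: power2_eq_square mult_ac)
  then have "(1 + \<sigma>) * (- \<tau> * (s \<bullet> grad x)) \<le> (1 + \<sigma>) * (f x - f y)"
    using \<sigma> by (intro mult_left_mono) auto
  moreover have "(1 + \<sigma>) * (- \<tau> * (s \<bullet> grad x)) = - (((1 + \<sigma>) * \<tau>) * (s \<bullet> grad x))"
    by (simp only: mult_minus_left mult_minus_right mult.assoc)
  ultimately have "- ((1 :: real) * (s \<bullet> grad x)) \<le> (1 + \<sigma>) * (f x - f y)"
    by (simp only: \<tau>(4))
  then show ?thesis
    by (simp add: s_def)
qed

end

section \<open>Products and sums of contraction factors\<close>

lemma prod_le_mean_power:
  fixes a :: "nat \<Rightarrow> real"
  assumes a: "\<And>t. t < k \<Longrightarrow> 0 \<le> a t" and sum: "(\<Sum>t<k. a t) \<le> X"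
  shows "(\<Prod>t<k. a t) \<le> (X / real k) ^ k"
proof (cases "k = 0")
  case False
  have P: "0 \<le> (\<Prod>t<k. a t)"
    using a by (intro prod_nonneg) auto
  have "p = (p powr (1 / real k)) ^ k" if "0 \<le> p" for p :: real
    using that False by (cases "p = 0") (simp_all add: powr_power)
  then have "(\<Prod>t<k. a t) = ((\<Prod>t<k. a t) powr (1 / real k)) ^ k"
    using P by blast
  also have "\<dots> \<le> (\<Sum>t<k. a t / real k) ^ k"
    using arith_geom_mean [of "{..<k}" a] a False by (intro power_mono) (auto simp: lessThan_empty_iff)
  also have "\<dots> \<le> (X / real k) ^ k"
    unfolding sum_divide_distrib [symmetric]
    using sum False a by (intro power_mono divide_right_mono divide_nonneg_nonneg sum_nonneg) auto
  finally show ?thesis .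
qed simp

text \<open>If all \<open>r t\<close> were equal, the hypothesis would say \<open>r t \<ge> exp (- A / k) / Q\<close>, and
\<open>exp (- A / k) \<ge> exp (- 1)\<close> since \<open>A \<le> k\<close>. In general \<open>r t\<close> lies above the tangent
of the exponential function at \<open>ln q\<close>, evaluated at \<open>ln (r t)\<close>, where \<open>q = 1 / (e Q)\<close>. Hence
the hypothesis, which is linear in \<open>ln (r t)\<close>, bounds the sum of the \<open>r t\<close> from below by
\<open>q k\<close>.\<close>

lemma prod_le_exp_of_log_sum:
  fixes r :: "nat \<Rightarrow> real"
  assumes r: "\<And>t. 0 < r t" "\<And>t. r t \<le> 1"
    and sum: "(\<Sum>t<k. - ln (r t)) \<le> A + real k * ln Q" and k: "A \<le> real k" and Q: "0 < Q"
  shows "(\<Prod>t<k. 1 - r t) \<le> exp (- real k / (exp 1 * Q))"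
proof -
  define q where "q = 1 / (exp 1 * Q)"
  have q: "0 < q" "ln q = - 1 - ln Q"
    using Q by (simp_all add: q_def ln_div ln_mult)
  have "q * (1 + ln (r t) - ln q) \<le> r t" for t
  proof -
    have "1 + (ln (r t) - ln q) \<le> exp (ln (r t) - ln q)"
      by (rule exp_ge_add_one_self)
    also have "\<dots> = r t / q"
      using r(1) q(1) by (simp add: exp_diff)
    finally show ?thesis
      using q(1) by (simp add: field_simps)
  qed
  then have "(\<Sum>t<k. q * (1 + ln (r t) - ln q)) \<le> (\<Sum>t<k. r t)"
    by (intro sum_mono)
  moreover have "(\<Sum>t<k. q * (1 + ln (r t) - ln q)) = q * (2 * real k + real k * ln Q - (\<Sum>t<k. - ln (r t)))"
    by (simp add: sum_distrib_left [symmetric] sum.distrib sum_subtractf sum_negf q(2) algebra_simps)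
  moreover have "q * real k \<le> q * (2 * real k + real k * ln Q - (\<Sum>t<k. - ln (r t)))"
    using q(1) sum k by (intro mult_left_mono) auto
  ultimately have sum_r: "q * real k \<le> (\<Sum>t<k. r t)"
    by linarith
  have "(\<Prod>t<k. 1 - r t) \<le> (\<Prod>t<k. exp (- r t))"
  proof (rule prod_mono)
    fix t
    show "0 \<le> 1 - r t \<and> 1 - r t \<le> exp (- r t)"
      using r(2) [of t] exp_ge_add_one_self [of "- r t"] by simp
  qed
  also have "\<dots> = exp (- (\<Sum>t<k. r t))"
    by (simp add: exp_sum [symmetric] sum_negf)
  also have "\<dots> \<le> exp (- real k / (exp 1 * Q))"
    using sum_r by (simp add: q_def)
  finally show ?thesis .
qed

lemma sum_exp_decay_le:
  assumes "0 < a"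
  shows "(\<Sum>t<k. exp (- a * real t)) \<le> 1 + 1 / a"
proof -
  define q where "q = exp (- a)"
  have q: "0 < q" "q < 1"
    using assms by (simp_all add: q_def)
  have "(\<Sum>t<k. exp (- a * real t)) = (\<Sum>t<k. q ^ t)"
    by (simp add: q_def exp_of_nat_mult [symmetric] mult.commute)
  also have "\<dots> = (1 - q ^ k) / (1 - q)"
    using q by (simp add: sum_gp_strict)
  also have "\<dots> \<le> 1 / (1 - q)"
    using q by (intro divide_right_mono) auto
  also have "\<dots> \<le> 1 + 1 / a"
  proof -
    have "q * (1 + a) \<le> q * exp a"
      using q exp_ge_add_one_self [of a] by (intro mult_left_mono) auto
    also have "\<dots> = 1"
      by (simp add: q_def exp_minus)
    finally show ?thesis
      using assms q by (simp add: field_simps)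
  qed
  finally show ?thesis .
qed

lemma sum_delayed_exp_decay_le:
  fixes w :: "nat \<Rightarrow> real"
  assumes a: "0 < a" and A: "0 \<le> A" and w: "\<And>t. w t \<le> 1"
    and decay: "\<And>t. A \<le> real t \<Longrightarrow> w t \<le> exp (- a * real t)"
  shows "(\<Sum>t<k. w t) \<le> A + 2 + 1 / a"
proof -
  define n where "n = nat \<lceil>A\<rceil>"
  have n: "A \<le> real n" "real n \<le> A + 1"
    using A by (simp_all add: n_def)
  have "w t \<le> (if t < n then 1 else 0) + exp (- a * real t)" for t
  proof (cases "t < n")
    case True
    then show ?thesis
      using w [of t] exp_gt_zero [of "- a * real t"] by (simp del: exp_gt_zero)
  next
    case False
    then have "A \<le> real t"
      using n by linarith
    then show ?thesis
      using decay False by simp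
  qed
  then have "(\<Sum>t<k. w t) \<le> (\<Sum>t<k. (if t < n then 1 else 0) + exp (- a * real t))"
    by (rule sum_mono)
  also have "\<dots> = real (card {t. t < k \<and> t < n}) + (\<Sum>t<k. exp (- a * real t))"
    by (simp add: sum.distrib sum.If_cases Int_def)
  also have "real (card {t. t < k \<and> t < n}) \<le> real n"
    using card_mono [of "{..<n}" "{t. t < k \<and> t < n}"] by auto
  finally show ?thesis
    using n sum_exp_decay_le [OF a, of k] by linarith
qed

section \<open>BFGS iterates\<close>

locale bfgs_run = smooth_strongly_convex f grad hess xs \<mu> L M
  for f :: "real^'n \<Rightarrow> real" and grad hess xs \<mu> L M +
  fixes x :: "nat \<Rightarrow> real^'n"
    and B :: "nat \<Rightarrow> real^'n^'n"
  assumes B0: "sym_pos_def (B 0)"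
    and bfgs: "bfgs_exact_line_search f grad x B"
    and not_opt: "\<And>k. x k \<noteq> xs"
begin

definition gap :: "nat \<Rightarrow> real" where
  "gap t = f (x t) - f xs"

definition step :: "nat \<Rightarrow> real^'n" where
  "step t = x (Suc t) - x t"

definition ratio :: "nat \<Rightarrow> real" where
  "ratio t = (gap t - gap (Suc t)) / gap t"

text \<open>A bound on the deviation of the Hessian, relative to \<open>hess xs\<close>, on the ball around \<open>xs\<close> that
contains the iterates from \<open>x t\<close> on: \<open>sqrt (2 * gap t / \<mu>)\<close> bounds the distance to
\<open>xs\<close>.\<close>

definition distortion :: "nat \<Rightarrow> real" where
  "distortion t = M / \<mu> * sqrt (2 * gap t / \<mu>)"

lemma gap_pos: "0 < gap t"
proof -
  have "0 < \<mu> / 2 * (norm (x t - xs))\<^sup>2"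
    using pos not_opt [of t] by simp
  then show ?thesis
    using strong_convexity_tangent [of xs "x t"] by (simp add: gap_def grad_minimizer)
qed

lemma grad_iterate_nonzero: "grad (x t) \<noteq> 0"
proof
  assume "grad (x t) = 0"
  then have "\<mu> / 2 * (norm (xs - x t))\<^sup>2 \<le> 0"
    using strong_convexity_tangent [of "x t" xs] gap_pos [of t] by (simp add: gap_def)
  then show False
    using pos not_opt [of t] by (simp add: mult_le_0_iff)
qed

text \<open>The quasi-Newton direction is a descent direction, so that the optimal step size is positive. It is
therefore an interior minimum and the new gradient is orthogonal to the step.\<close>

lemma bfgs_step:
  assumes B: "sym_pos_def (B t)"
  obtains \<eta> where "0 < \<eta>" "B t *v step t = - \<eta> *\<^sub>R grad (x t)"
    "step t \<bullet> grad (x (Suc t)) = 0" "step t \<bullet> grad (x t) < 0" "f (x (Suc t)) \<le> f (x t)"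
    "B (Suc t) = bfgs_update (B t) (step t) (grad (x (Suc t)) - grad (x t))"
proof -
  define d where "d = - (matrix_inv (B t) *v grad (x t))"
  obtain \<eta> where \<eta>: "is_arg_min (\<lambda>u. f (x t + u *\<^sub>R d)) (\<lambda>u. 0 \<le> u) \<eta>"
    and x': "x (Suc t) = x t + \<eta> *\<^sub>R d"
    and B': "B (Suc t) = bfgs_update (B t) (x (Suc t) - x t) (grad (x (Suc t)) - grad (x t))"
    using bfgs unfolding bfgs_exact_line_search_def Let_def d_def by blast
  have min: "f (x t + \<eta> *\<^sub>R d) \<le> f (x t + u *\<^sub>R d)" if "0 \<le> u" for u
    using \<eta> that by (auto simp: is_arg_min_def not_less)
  have Bd: "B t *v d = - grad (x t)"
    using invertible_mult_matrix_inv(1) [OF sym_pos_def_invertible [OF B]]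
    by (simp add: d_def matrix_vector_mult_uminus matrix_vector_mul_assoc)
  then have "d \<noteq> 0"
    using grad_iterate_nonzero [of t] by auto
  then have "0 < d \<bullet> (B t *v d)"
    using B by (simp add: sym_pos_def_def)
  then have descent: "d \<bullet> grad (x t) < 0"
    by (simp add: Bd)
  have "\<eta> \<noteq> 0"
  proof
    assume "\<eta> = 0"
    have "((\<lambda>u. f (x t + u *\<^sub>R d)) has_real_derivative d \<bullet> grad (x t)) (at 0)"
      using f_line_derivative [of "x t" d 0] by simp
    then obtain e where "0 < e" "\<And>h. 0 < h \<Longrightarrow> h < e \<Longrightarrow> f (x t + (0 + h) *\<^sub>R d) < f (x t + 0 *\<^sub>R d)"
      using DERIV_neg_dec_right descent by blast
    from this(2) [of "e / 2"] \<open>0 < e\<close> min [of "e / 2"] show False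
      by (simp add: \<open>\<eta> = 0\<close>)
  qed
  then have "0 < \<eta>"
    using \<eta> by (simp add: is_arg_min_def)
  have "d \<bullet> grad (x t + \<eta> *\<^sub>R d) = 0"
  proof (rule DERIV_local_min [OF f_line_derivative \<open>0 < \<eta>\<close>], intro allI impI)
    fix u assume "\<bar>\<eta> - u\<bar> < \<eta>"
    then show "f (x t + \<eta> *\<^sub>R d) \<le> f (x t + u *\<^sub>R d)"
      by (intro min) linarith
  qed
  moreover have st: "step t = \<eta> *\<^sub>R d"
    by (simp add: step_def x')
  ultimately show thesis
    using that [of \<eta>] \<open>0 < \<eta>\<close> descent min [of 0] B'
    by (simp add: st x' Bd matrix_vector_mult_scaleR mult_pos_neg flip: step_def)
qed

lemma sym_pos_def_B: "sym_pos_def (B t)"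
proof (induction t)
  case 0
  show ?case
    by (rule B0)
next
  case (Suc t)
  obtain \<eta> where \<eta>: "step t \<bullet> grad (x (Suc t)) = 0" "step t \<bullet> grad (x t) < 0"
    "B (Suc t) = bfgs_update (B t) (step t) (grad (x (Suc t)) - grad (x t))"
    by (rule bfgs_step [OF Suc.IH]) blast
  moreover have "step t \<noteq> 0"
    using \<eta>(2) by auto
  ultimately show ?case
    using sym_pos_def_bfgs_update [OF Suc.IH] by (simp add: inner_diff_right)
qed

lemma gap_Suc_le: "gap (Suc t) \<le> gap t"
  using bfgs_step [OF sym_pos_def_B] unfolding gap_def by (metis diff_right_mono)

lemma gap_le_gap_0: "gap t \<le> gap 0"
  by (rule lift_Suc_antimono_le [of gap]) (simp_all add: gap_Suc_le)

text \<open>The weight enters through three constants. Since \<open>s \<bullet> y \<le> k * ratio t * gap t\<close> and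
\<open>|R g|\<^sup>2 \<ge> 2 * gap t / c\<close>, the logarithm in the one-step bound for \<open>Psi\<close> is at most
\<open>ln (ratio t) + ln (k c / 2)\<close>, and \<open>c'\<close> bounds the remaining quotient.\<close>

lemma Psi_step_le:
  fixes R :: "real^'n^'n"
  assumes R: "transpose R = R" "invertible R"
    and decrease: "- (step t \<bullet> grad (x t)) \<le> k * (gap t - gap (Suc t))"
    and domination: "2 * gap t \<le> c * (norm (R *v grad (x t)))\<^sup>2"
    and secant: "(norm (R *v (grad (x (Suc t)) - grad (x t))))\<^sup>2
      \<le> c' * (step t \<bullet> (grad (x (Suc t)) - grad (x t)))"
    and kc: "0 < k" "0 < c"
  shows "0 < ratio t" "ratio t < 1"
    "Psi (R ** B (Suc t) ** R) - ln (ratio t) \<le> Psi (R ** B t ** R) + (c' - 1) + ln (k * c / 2)"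
proof -
  obtain \<eta> where \<eta>: "0 < \<eta>" "B t *v step t = - \<eta> *\<^sub>R grad (x t)"
    "step t \<bullet> grad (x (Suc t)) = 0" "step t \<bullet> grad (x t) < 0"
    "B (Suc t) = bfgs_update (B t) (step t) (grad (x (Suc t)) - grad (x t))"
    by (rule bfgs_step [OF sym_pos_def_B]) blast
  define y where "y = grad (x (Suc t)) - grad (x t)"
  define G where "G = (norm (R *v grad (x t)))\<^sup>2"
  have sy: "step t \<bullet> y = - (step t \<bullet> grad (x t))"
    using \<eta>(3) by (simp add: y_def inner_diff_right)
  then have sy_pos: "0 < step t \<bullet> y"
    using \<eta>(4) by simp
  then have s: "step t \<noteq> 0"
    by auto
  have "0 < k * (gap t - gap (Suc t))"
    using decrease sy_pos sy by simp
  then have diff: "0 < gap t - gap (Suc t)"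
    using kc by (simp add: zero_less_mult_iff)
  then show ratio: "0 < ratio t" "ratio t < 1"
    using gap_pos by (simp_all add: ratio_def)
  have "0 < c * G"
    using domination gap_pos [of t] by (simp add: G_def)
  then have G: "0 < G"
    using kc by (simp add: zero_less_mult_iff)
  have "step t \<bullet> y \<le> k * (ratio t * gap t)"
    using decrease sy gap_pos [of t] by (simp add: ratio_def)
  also have "\<dots> \<le> k * (ratio t * (c / 2 * G))"
    using domination kc ratio by (intro mult_left_mono) (auto simp: G_def)
  finally have "step t \<bullet> y / G \<le> ratio t * (k * c / 2)"
    using G by (simp add: pos_divide_le_eq mult_ac)
  then have "ln (step t \<bullet> y / G) \<le> ln (ratio t * (k * c / 2))"
    using sy_pos G by (intro ln_mono) auto
  also have "\<dots> = ln (ratio t) + ln (k * c / 2)"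
    using ratio kc by (intro ln_mult_pos) auto
  finally have "ln (step t \<bullet> y / G) \<le> ln (ratio t) + ln (k * c / 2)" .
  moreover have "Psi (R ** B (Suc t) ** R)
      \<le> Psi (R ** B t ** R) + ((norm (R *v y))\<^sup>2 / (step t \<bullet> y) - 1) + ln (step t \<bullet> y / G)"
    unfolding \<eta>(5) G_def y_def [symmetric]
    by (rule Psi_bfgs_step_le [OF sym_pos_def_B s sy_pos R \<eta>(2,1) sy])
  moreover have "(norm (R *v y))\<^sup>2 / (step t \<bullet> y) \<le> c'"
    using secant sy_pos by (simp add: y_def [symmetric] pos_divide_le_eq)
  ultimately show "Psi (R ** B (Suc t) ** R) - ln (ratio t)
      \<le> Psi (R ** B t ** R) + (c' - 1) + ln (k * c / 2)"
    by linarith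
qed

lemma exact_step: "step t \<bullet> grad (x (Suc t)) = 0"
  using bfgs_step [OF sym_pos_def_B] by blast

lemma decrease_sqrt_condition_number:
  "- (step t \<bullet> grad (x t)) \<le> (1 + sqrt (L / \<mu>)) * (gap t - gap (Suc t))"
proof -
  have "- ((x (Suc t) - x t) \<bullet> grad (x t)) \<le> (1 + sqrt (L / \<mu>)) * (f (x t) - f (x (Suc t)))"
  proof (rule exact_line_search_decrease [where a = "\<mu> * (norm (step t))\<^sup>2"])
    fix z
    show "\<mu> * (norm (step t))\<^sup>2 \<le> (x (Suc t) - x t) \<bullet> (hess z *v (x (Suc t) - x t))"
      by (simp add: hess_bounds flip: step_def)
    show "(x (Suc t) - x t) \<bullet> (hess z *v (x (Suc t) - x t))
        \<le> (sqrt (L / \<mu>))\<^sup>2 * (\<mu> * (norm (step t))\<^sup>2)"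
      using hess_bounds(2) [of "step t" z] pos by (simp flip: step_def)
  qed (use exact_step [of t] pos in \<open>simp_all add: step_def\<close>)
  then show ?thesis
    by (simp add: step_def gap_def)
qed

lemma distortion_nonneg: "0 \<le> distortion t"
  using pos gap_pos [of t] by (simp add: distortion_def)

text \<open>The Lipschitz condition bounds the absolute error of the Hessian by \<open>M |z - xs|\<close>; as every
Hessian is at least \<open>\<mu> I\<close>, this is a relative error of at most \<open>M |z - xs| / \<mu>\<close>.\<close>

lemma hess_distortion:
  assumes "norm (z - xs) \<le> sqrt (2 * gap t / \<mu>)"
  shows "v \<bullet> (hess z *v v) \<le> (1 + distortion t) * (v \<bullet> (hess xs *v v))"
    and "v \<bullet> (hess xs *v v) \<le> (1 + distortion t) * (v \<bullet> (hess z *v v))"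
proof -
  have "M * norm (z - xs) * (norm v)\<^sup>2 \<le> distortion t * (\<mu> * (norm v)\<^sup>2)"
    using pos assms by (simp add: distortion_def mult_left_mono mult_right_mono)
  also have "\<dots> \<le> distortion t * (v \<bullet> (hess w *v v))" for w
    using hess_bounds(1) distortion_nonneg by (intro mult_left_mono)
  finally have "\<bar>v \<bullet> (hess z *v v) - v \<bullet> (hess xs *v v)\<bar> \<le> distortion t * (v \<bullet> (hess w *v v))" for w
    using hess_near_minimizer [of v z] by (meson order_trans)
  from this [of z] this [of xs] show "v \<bullet> (hess z *v v) \<le> (1 + distortion t) * (v \<bullet> (hess xs *v v))"
    "v \<bullet> (hess xs *v v) \<le> (1 + distortion t) * (v \<bullet> (hess z *v v))"
    by (simp_all add: distrib_right)
qed

lemma norm_iterate_le: "norm (x t - xs) \<le> sqrt (2 * gap t / \<mu>)"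
  unfolding gap_def by (rule dist_minimizer_le)

lemma segment_near_minimizer:
  assumes "norm (u - xs) \<le> r" "norm (v - xs) \<le> r" "z \<in> closed_segment u v"
  shows "norm (z - xs) \<le> r"
proof -
  have "closed_segment u v \<subseteq> cball xs r"
    using assms by (intro closed_segment_subset) (auto simp: dist_norm norm_minus_commute)
  with assms(3) show ?thesis
    by (auto simp: dist_norm norm_minus_commute)
qed

lemma step_segment_near_minimizer:
  assumes "z \<in> closed_segment (x t) (x (Suc t))"
  shows "norm (z - xs) \<le> sqrt (2 * gap t / \<mu>)"
proof (rule segment_near_minimizer [OF norm_iterate_le _ assms])
  have "sqrt (2 * gap (Suc t) / \<mu>) \<le> sqrt (2 * gap t / \<mu>)"
    using gap_Suc_le pos by (intro real_sqrt_le_mono divide_right_mono) auto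
  then show "norm (x (Suc t) - xs) \<le> sqrt (2 * gap t / \<mu>)"
    using norm_iterate_le [of "Suc t"] by linarith
qed

text \<open>Along the step all Hessians lie between \<open>hess xs / D\<close> and \<open>D * hess xs\<close> with
\<open>D = 1 + distortion t\<close>, so that \<open>D\<close> takes the place of \<open>sqrt (L / \<mu>)\<close>. Near the minimizer
the constant tends to \<open>2\<close>, its value for a quadratic function.\<close>

lemma decrease_distortion:
  "- (step t \<bullet> grad (x t)) \<le> (2 + distortion t) * (gap t - gap (Suc t))"
proof -
  define D where "D = 1 + distortion t"
  have D: "0 < D"
    using distortion_nonneg [of t] by (simp add: D_def)
  have "- ((x (Suc t) - x t) \<bullet> grad (x t)) \<le> (1 + D) * (f (x t) - f (x (Suc t)))"
  proof (rule exact_line_search_decrease [where a = "step t \<bullet> (hess xs *v step t) / D"])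
    fix z assume "z \<in> closed_segment (x t) (x (Suc t))"
    note H = hess_distortion [OF step_segment_near_minimizer [OF this], of "step t", folded D_def]
    show "step t \<bullet> (hess xs *v step t) / D \<le> (x (Suc t) - x t) \<bullet> (hess z *v (x (Suc t) - x t))"
      using H(2) D by (simp add: pos_divide_le_eq mult.commute flip: step_def)
    show "(x (Suc t) - x t) \<bullet> (hess z *v (x (Suc t) - x t))
        \<le> D\<^sup>2 * (step t \<bullet> (hess xs *v step t) / D)"
      using H(1) D by (simp add: power2_eq_square flip: step_def)
  qed (use exact_step [of t] D in \<open>simp_all add: step_def\<close>)
  then show ?thesis
    by (simp add: step_def gap_def D_def)
qed

text \<open>For \<open>P = S S\<close> the vector \<open>R (R v)\<close> is the solution of \<open>P w = v\<close>, in the form in which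
\<open>secant_norm_le\<close> takes it.\<close>

lemma weighted_norm_solution:
  fixes R S :: "real^'n^'n"
  assumes "transpose R = R" "S ** R = mat 1"
  shows "(S ** S) *v (R *v (R *v v)) = v" "(R *v (R *v v)) \<bullet> v = (norm (R *v v))\<^sup>2"
proof -
  have "(S ** S) *v (R *v (R *v v)) = S *v ((S ** R) *v (R *v v))"
    by (simp add: matrix_vector_mul_assoc matrix_mul_assoc)
  also have "\<dots> = (S ** R) *v v"
    by (simp add: assms matrix_vector_mul_assoc)
  finally show "(S ** S) *v (R *v (R *v v)) = v"
    by (simp add: assms)
  show "(R *v (R *v v)) \<bullet> v = (norm (R *v v))\<^sup>2"
    by (simp add: symmetric_inner_mult [OF assms(1)] power2_norm_eq_inner)
qed

text \<open>The weight \<open>P = L I\<close>: the Hessian lies between \<open>(\<mu> / L) P\<close> and \<open>P\<close>.\<close>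

lemma Psi_global_step:
  assumes k: "- (step t \<bullet> grad (x t)) \<le> k * (gap t - gap (Suc t))" "0 < k"
  shows "0 < ratio t" "ratio t < 1"
    "Psi ((1 / L) *\<^sub>R B (Suc t)) - ln (ratio t) \<le> Psi ((1 / L) *\<^sub>R B t) + ln (k * (L / \<mu>) / 2)"
proof -
  define R S :: "real^'n^'n" where "R = (1 / sqrt L) *\<^sub>R mat 1" and "S = sqrt L *\<^sub>R mat 1"
  have Rv: "R *v v = (1 / sqrt L) *\<^sub>R v" and Sv: "S *v v = sqrt L *\<^sub>R v" for v
    by (simp_all add: R_def S_def flip: scaleR_matrix_vector_assoc)
  have SL: "sqrt L * sqrt L = L" "0 < sqrt L"
    using pos by auto
  have RS: "R ** S = mat 1" "S ** R = mat 1" "S ** S = L *\<^sub>R mat 1"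
    using SL by (simp_all add: matrix_eq Rv Sv flip: matrix_vector_mul_assoc scaleR_matrix_vector_assoc)
  have R: "transpose R = R"
    by (auto simp: R_def transpose_def mat_def vec_eq_iff)
  have inv_R: "invertible R"
    using RS by (auto simp: invertible_def)
  have RBR: "R ** A ** R = (1 / L) *\<^sub>R A" for A
    using SL by (simp add: matrix_eq Rv matrix_vector_mult_scaleR flip: matrix_vector_mul_assoc scaleR_matrix_vector_assoc)
  have domination: "2 * gap t \<le> L / \<mu> * (norm (R *v grad (x t)))\<^sup>2"
    unfolding gap_def
  proof (rule gradient_domination [OF _ _ R RS(1)])
    fix z
    show "(norm (S *v (x t - xs)))\<^sup>2 \<le> L / \<mu> * ((x t - xs) \<bullet> (hess z *v (x t - xs)))"
      using mult_left_mono [OF hess_bounds(1) [of "x t - xs" z], of "L / \<mu>"] pos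
      by (simp add: Sv power_mult_distrib)
  qed (use pos in simp)
  have secant: "(norm (R *v (grad (x (Suc t)) - grad (x t))))\<^sup>2
      \<le> 1 * (step t \<bullet> (grad (x (Suc t)) - grad (x t)))"
    unfolding step_def weighted_norm_solution(2) [OF R RS(2), symmetric]
  proof (rule secant_norm_le [OF _ _ weighted_norm_solution(1) [OF R RS(2)]])
    fix z v :: "real^'n"
    show "v \<bullet> (hess z *v v) \<le> 1 * (v \<bullet> ((S ** S) *v v))"
      using hess_bounds(2) [of v z] by (simp add: RS(3) power2_norm_eq_inner flip: scaleR_matrix_vector_assoc)
  qed simp
  note step = Psi_step_le [OF R inv_R k(1) domination secant k(2)]
  show "0 < ratio t" "ratio t < 1"
    "Psi ((1 / L) *\<^sub>R B (Suc t)) - ln (ratio t) \<le> Psi ((1 / L) *\<^sub>R B t) + ln (k * (L / \<mu>) / 2)"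
    using step pos by (simp_all add: RBR)
qed

lemma inverse_sqrt_hess_minimizer:
  defines "S \<equiv> matrix_sqrt (hess xs)"
  defines "R \<equiv> matrix_inv S"
  shows "S ** S = hess xs" "R ** S = mat 1" "S ** R = mat 1" "transpose S = S" "transpose R = R"
    "invertible R"
proof -
  have S: "sym_pos_def S" and SS: "S ** S = hess xs"
    unfolding S_def by (rule matrix_sqrt_sym_pos_def [OF sym_pos_def_hess])+
  note inv = invertible_mult_matrix_inv [OF sym_pos_def_invertible [OF S], folded R_def]
  show "S ** S = hess xs" "R ** S = mat 1" "S ** R = mat 1"
    using SS inv by auto
  show symS: "transpose S = S"
    using S by (simp add: sym_pos_def_def)
  have "transpose R ** S = mat 1"
    using arg_cong [OF inv(1), of transpose] by (simp add: matrix_transpose_mul symS)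
  then show "transpose R = R"
    by (metis inv(1) matrix_mul_assoc matrix_mul_lid matrix_mul_rid)
  show "invertible R"
    using inv by (auto simp: invertible_def)
qed

text \<open>The weight \<open>P = hess xs\<close>: with \<open>D\<close> the distortion, the Hessians met in step \<open>t\<close> lie between
\<open>P / (1 + D)\<close> and \<open>(1 + D) P\<close>. The cost \<open>D + ln ((2 + D) (1 + D) / 2)\<close> is zero for
\<open>D = 0\<close> and at most linear in \<open>D\<close>, since \<open>ln (1 + u) \<le> u\<close>.\<close>

lemma Psi_local_step:
  defines "R \<equiv> matrix_inv (matrix_sqrt (hess xs))"
  shows "Psi (R ** B (Suc t) ** R) - ln (ratio t) \<le> Psi (R ** B t ** R) + 5 / 2 * distortion t"
proof -
  define S where "S = matrix_sqrt (hess xs)"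
  have R: "R = matrix_inv S"
    by (simp add: R_def S_def)
  note RS = inverse_sqrt_hess_minimizer [folded S_def, folded R]
  define D where "D = distortion t"
  have D: "0 \<le> D"
    using distortion_nonneg by (simp add: D_def)
  have norm_S: "(norm (S *v v))\<^sup>2 = v \<bullet> (hess xs *v v)" for v
    by (simp add: power2_norm_eq_inner symmetric_inner_mult [OF RS(4)] matrix_vector_mul_assoc RS(1))
  have domination: "2 * gap t \<le> (1 + D) * (norm (R *v grad (x t)))\<^sup>2"
    unfolding gap_def
  proof (rule gradient_domination [OF _ _ RS(5,2)])
    fix z assume z: "z \<in> closed_segment (x t) xs"
    have "norm (z - xs) \<le> sqrt (2 * gap t / \<mu>)"
      using gap_pos [of t] pos
      by (intro segment_near_minimizer [OF norm_iterate_le _ z]) simp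
    then show "(norm (S *v (x t - xs)))\<^sup>2 \<le> (1 + D) * ((x t - xs) \<bullet> (hess z *v (x t - xs)))"
      unfolding norm_S D_def by (rule hess_distortion(2))
  qed (use D in simp)
  have secant: "(norm (R *v (grad (x (Suc t)) - grad (x t))))\<^sup>2
      \<le> (1 + D) * (step t \<bullet> (grad (x (Suc t)) - grad (x t)))"
    unfolding step_def weighted_norm_solution(2) [OF RS(5,3), symmetric]
  proof (rule secant_norm_le [OF _ _ weighted_norm_solution(1) [OF RS(5,3)]])
    fix z v :: "real^'n" assume "z \<in> closed_segment (x t) (x (Suc t))"
    then show "v \<bullet> (hess z *v v) \<le> (1 + D) * (v \<bullet> ((S ** S) *v v))"
      unfolding RS(1) D_def by (intro hess_distortion(1) step_segment_near_minimizer)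
  qed (use D in simp)
  have "Psi (R ** B (Suc t) ** R) - ln (ratio t)
      \<le> Psi (R ** B t ** R) + (1 + D - 1) + ln ((2 + D) * (1 + D) / 2)"
    using Psi_step_le(3) [OF RS(5,6) decrease_distortion domination [unfolded D_def] secant [unfolded D_def]]
      D by (simp add: D_def)
  moreover have "ln ((2 + D) * (1 + D) / 2) \<le> 3 / 2 * D"
  proof -
    have "ln ((2 + D) * (1 + D) / 2) = ln (1 + D / 2) + ln (1 + D)"
      using D by (subst ln_mult_pos [symmetric]) (auto simp: field_simps)
    then show ?thesis
      using D ln_add_one_self_le_self [of D] ln_add_one_self_le_self [of "D / 2"] by simp
  qed
  ultimately show ?thesis
    by (simp add: D_def)
qed

lemma ratio_bounds: "0 < ratio t" "ratio t < 1"
proof -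
  have "0 < 1 + sqrt (L / \<mu>)"
    using pos by (simp add: add_pos_nonneg)
  from Psi_global_step(1,2) [OF decrease_sqrt_condition_number this]
  show "0 < ratio t" "ratio t < 1"
    by auto
qed

lemma gap_prod_ratio: "gap k / gap 0 = (\<Prod>t<k. 1 - ratio t)"
proof (induction k)
  case 0
  show ?case
    using gap_pos [of 0] by simp
next
  case (Suc k)
  have "1 - ratio k = gap (Suc k) / gap k"
    using gap_pos [of k] by (simp add: ratio_def field_simps)
  then have "(\<Prod>t<Suc k. 1 - ratio t) = gap k / gap 0 * (gap (Suc k) / gap k)"
    by (simp add: Suc.IH)
  then show ?case
    using gap_pos [of k] by simp
qed

lemma telescope_Psi:
  fixes A :: "nat \<Rightarrow> real^'n^'n"
  assumes step: "\<And>t. Psi (A (Suc t)) - ln (ratio t) \<le> Psi (A t) + e t" and A: "\<And>t. sym_pos_def (A t)"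
  shows "(\<Sum>t<k. - ln (ratio t)) \<le> Psi (A 0) + (\<Sum>t<k. e t)"
proof -
  have "Psi (A k) + (\<Sum>t<k. - ln (ratio t)) \<le> Psi (A 0) + (\<Sum>t<k. e t)"
  proof (induction k)
    case (Suc k)
    then show ?case
      using step [of k] by simp
  qed simp
  then show ?thesis
    using Psi_nonneg [OF A, of k] by linarith
qed

lemma distortion_eq:
  "distortion t = M / \<mu> powr (3 / 2) * sqrt (2 * gap 0) * sqrt (gap t / gap 0)"
proof -
  have "\<mu> powr (3 / 2) = \<mu> * sqrt \<mu>"
    using pos powr_add [of \<mu> 1 "1 / 2"] by (simp add: powr_half_sqrt)
  moreover have "sqrt (2 * gap 0) * sqrt (gap t / gap 0) = sqrt (2 * gap t)"
    using gap_pos [of 0] by (simp flip: real_sqrt_mult)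
  ultimately have "M / \<mu> powr (3 / 2) * (sqrt (2 * gap 0) * sqrt (gap t / gap 0))
      = M / (\<mu> * sqrt \<mu>) * sqrt (2 * gap t)"
    by (simp only:)
  then show ?thesis
    by (simp add: distortion_def real_sqrt_divide mult.assoc)
qed

text \<open>The constant \<open>K\<close> is the better of the two line search constants \<open>2 + distortion t\<close> and
\<open>1 + sqrt \<kappa>\<close>. The weight \<open>L I\<close> gives decay of the gap with rate
\<open>2 / (e K \<kappa>)\<close> after \<open>\<Psi>\<close> steps, hence the sum of the roots of the relative gaps is at most
\<open>\<Psi> + 2 + e K \<kappa> \<le> \<Psi> + 4 K \<kappa>\<close>. The weight \<open>hess xs\<close> charges
\<open>5 / 4 * C0\<close> for each unit of this sum, well within the constants \<open>4\<close> and \<open>12\<close>.\<close>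

theorem superlinear_rate:
  fixes k :: nat
  defines "\<kappa> \<equiv> L / \<mu>"
    and "C0 \<equiv> 2 * M / \<mu> powr (3 / 2) * sqrt (2 * gap 0)"
    and "R \<equiv> matrix_inv (matrix_sqrt (hess xs))"
  shows "gap k / gap 0 \<le> ((Psi (R ** B 0 ** R) + 4 * C0 * Psi ((1 / L) *\<^sub>R B 0)
      + 12 * C0 * \<kappa> * min (2 * (1 + C0)) (1 + sqrt \<kappa>)) / real k) ^ k"
proof -
  define K where "K = min (2 * (1 + C0)) (1 + sqrt \<kappa>)"
  define \<Psi> where "\<Psi> = Psi ((1 / L) *\<^sub>R B 0)"
  have D: "distortion t = C0 / 2 * sqrt (gap t / gap 0)" for t
    by (simp add: distortion_eq C0_def)
  have C0: "0 \<le> C0"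
    using pos gap_pos [of 0] by (simp add: C0_def)
  have \<kappa>: "1 \<le> \<kappa>"
    using mu_le_L pos by (simp add: \<kappa>_def)
  have K: "2 \<le> K" "2 \<le> K * \<kappa>"
  proof -
    show "2 \<le> K"
      using C0 \<kappa> by (simp add: K_def)
    then show "2 \<le> K * \<kappa>"
      using mult_mono [of 2 K 1 \<kappa>] \<kappa> by simp
  qed
  have sqrt_gap: "sqrt (gap t / gap 0) \<le> 1" for t
    using gap_le_gap_0 [of t] gap_pos [of 0] by simp
  have spd_scaled: "sym_pos_def ((1 / L) *\<^sub>R B t)" for t
    using sym_pos_def_B [of t] pos
    by (auto simp: sym_pos_def_def transpose_def vec_eq_iff simp flip: scaleR_matrix_vector_assoc)
  have \<Psi>: "0 \<le> \<Psi>"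
    unfolding \<Psi>_def by (rule Psi_nonneg [OF spd_scaled])
  have decrease: "- (step t \<bullet> grad (x t)) \<le> K * (gap t - gap (Suc t))" for t
  proof -
    have "- (step t \<bullet> grad (x t)) \<le> (2 * (1 + C0)) * (gap t - gap (Suc t))"
    proof -
      have "C0 / 2 * sqrt (gap t / gap 0) \<le> C0 / 2 * 1"
        using C0 sqrt_gap by (intro mult_left_mono) auto
      then have "2 + distortion t \<le> 2 * (1 + C0)"
        using C0 unfolding D by simp
      then have "(2 + distortion t) * (gap t - gap (Suc t)) \<le> (2 * (1 + C0)) * (gap t - gap (Suc t))"
        using gap_Suc_le [of t] by (intro mult_right_mono) auto
      then show ?thesis
        using decrease_distortion [of t] by linarith
    qed
    then show ?thesis
      using decrease_sqrt_condition_number [of t] by (simp add: K_def \<kappa>_def min_def)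
  qed
  have "(\<Sum>t<n. - ln (ratio t)) \<le> \<Psi> + (\<Sum>t<n. ln (K * \<kappa> / 2))" for n
    unfolding \<Psi>_def
    using Psi_global_step(3) [OF decrease] K spd_scaled
    by (intro telescope_Psi [where A = "\<lambda>t. (1 / L) *\<^sub>R B t"]) (auto simp: \<kappa>_def)
  then have linear_sum: "(\<Sum>t<n. - ln (ratio t)) \<le> \<Psi> + real n * ln (K * \<kappa> / 2)" for n
    by simp
  define a where "a = 1 / (exp 1 * (K * \<kappa>))"
  have a: "0 < a"
    using K by (simp add: a_def)
  have sum_w: "(\<Sum>t<k. sqrt (gap t / gap 0)) \<le> \<Psi> + 2 + 1 / a"
  proof (rule sum_delayed_exp_decay_le [OF a \<Psi> sqrt_gap])
    fix t assume "\<Psi> \<le> real t"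
    then have "gap t / gap 0 \<le> exp (- real t / (exp 1 * (K * \<kappa> / 2)))"
      unfolding gap_prod_ratio using ratio_bounds K
      by (intro prod_le_exp_of_log_sum [OF _ _ linear_sum]) (auto simp: less_imp_le)
    also have "\<dots> = (exp (- a * real t))\<^sup>2"
      by (simp add: a_def flip: exp_double)
    finally show "sqrt (gap t / gap 0) \<le> exp (- a * real t)"
      by (simp add: real_le_lsqrt)
  qed
  also have "\<dots> \<le> \<Psi> + 4 * (K * \<kappa>)"
  proof -
    have "exp 1 * (K * \<kappa>) \<le> 3 * (K * \<kappa>)"
      using exp_le K by (intro mult_right_mono) auto
    moreover have "1 / a = exp 1 * (K * \<kappa>)"
      by (simp add: a_def)
    ultimately show ?thesis
      using K(2) by linarith
  qed
  finally have "5 / 4 * C0 * (\<Sum>t<k. sqrt (gap t / gap 0)) \<le> 5 / 4 * C0 * (\<Psi> + 4 * (K * \<kappa>))"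
    using C0 by (intro mult_left_mono) auto
  also have "\<dots> \<le> 4 * C0 * \<Psi> + 12 * C0 * \<kappa> * K"
  proof -
    have "0 \<le> C0 * \<Psi>" "0 \<le> C0 * (K * \<kappa>)"
      using C0 \<Psi> K by auto
    then show ?thesis
      by (simp add: algebra_simps)
  qed
  finally have sum_distortion: "5 / 4 * C0 * (\<Sum>t<k. sqrt (gap t / gap 0)) \<le> 4 * C0 * \<Psi> + 12 * C0 * \<kappa> * K" .
  have "(\<Sum>t<k. - ln (ratio t)) \<le> Psi (R ** B 0 ** R) + (\<Sum>t<k. 5 / 2 * distortion t)"
  proof (rule telescope_Psi [where A = "\<lambda>t. R ** B t ** R"])
    show "Psi (R ** B (Suc t) ** R) - ln (ratio t) \<le> Psi (R ** B t ** R) + 5 / 2 * distortion t" for t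
      unfolding R_def by (rule Psi_local_step)
    show "sym_pos_def (R ** B t ** R)" for t
      using sym_pos_def_congruence [OF sym_pos_def_B inverse_sqrt_hess_minimizer(6), of t]
      by (simp add: inverse_sqrt_hess_minimizer(5) R_def)
  qed
  also have "(\<Sum>t<k. 5 / 2 * distortion t) = 5 / 4 * C0 * (\<Sum>t<k. sqrt (gap t / gap 0))"
    by (simp add: D sum_distrib_left mult_ac)
  finally have total: "(\<Sum>t<k. - ln (ratio t)) \<le> Psi (R ** B 0 ** R) + 4 * C0 * \<Psi> + 12 * C0 * \<kappa> * K"
    using sum_distortion by linarith
  have "(\<Sum>t<k. 1 - ratio t) \<le> (\<Sum>t<k. - ln (ratio t))"
  proof (rule sum_mono)
    show "1 - ratio t \<le> - ln (ratio t)" for t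
      using ln_le_minus_one [OF ratio_bounds(1) [of t]] by simp
  qed
  then have "(\<Prod>t<k. 1 - ratio t)
      \<le> ((Psi (R ** B 0 ** R) + 4 * C0 * \<Psi> + 12 * C0 * \<kappa> * K) / real k) ^ k"
    using total ratio_bounds by (intro prod_le_mean_power) (auto simp: less_imp_le)
  then show ?thesis
    unfolding gap_prod_ratio K_def \<Psi>_def .
qed

end

theorem theorem2:
  fixes f :: "real^'n \<Rightarrow> real"
    and grad :: "real^'n \<Rightarrow> real^'n"
    and hess :: "real^'n \<Rightarrow> real^'n^'n"
    and xs :: "real^'n"
    and \<mu> L M :: real
    and x :: "nat \<Rightarrow> real^'n"
    and B :: "nat \<Rightarrow> real^'n^'n"
  assumes grad: "\<And>z. GDERIV f z :> grad z"
    and hess: "\<And>z. (grad has_derivative (\<lambda>h. hess z *v h)) (at z)"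
    and hess_cont: "continuous_on UNIV hess"
    and minimizer: "\<And>z. f xs \<le> f z"
    and pos: "0 < \<mu>" "0 < L" "0 < M"
    and strongly_convex: "strongly_convex \<mu> f"
    and grad_Lipschitz: "\<And>y z. norm (grad y - grad z) \<le> L * norm (y - z)"
    and hess_Lipschitz: "\<And>z. spectral_norm (hess z - hess xs) \<le> M * norm (z - xs)"
    and B0: "sym_pos_def (B 0)"
    and bfgs: "bfgs_exact_line_search f grad x B"
    and not_opt: "\<And>k. x k \<noteq> xs"
  shows "let \<kappa> = L / \<mu>;
             C0 = 2 * M / \<mu> powr (3 / 2) * sqrt (2 * (f (x 0) - f xs));
             B0_bar = (1 / L) *\<^sub>R B 0;
             R = matrix_inv (matrix_sqrt (hess xs));
             B0_tilde = R ** B 0 ** R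
         in \<forall>k\<ge>1. (f (x k) - f xs) / (f (x 0) - f xs)
              \<le> ((Psi B0_tilde + 4 * C0 * Psi B0_bar
                    + 12 * C0 * \<kappa> * min (2 * (1 + C0)) (1 + sqrt \<kappa>)) / real k) ^ k"
proof -
  interpret bfgs_run f grad hess xs \<mu> L M x B
    using assms by unfold_locales
  show ?thesis
    using superlinear_rate by (simp only: Let_def gap_def) blast
qed

end
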